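(* Let $n\geq1$ and let $D\subset S^{n-1}\subset\mathbb{R}^n$ be any set. Let $N(D)=\{x\in\mathbb{R}^n : x\cdot v=0\text{ for some }v\in D\}$. For a Schwartz function $f\in\mathcal{S}(\mathbb{R}^n)$ the following are equivalent: (1) For every $v\in D$ the function $R_vf\colon\mathbb{R}^n\to\mathbb{C}$, $R_vf(x)=\int_{\mathbb{R}}f(x+tv)\,\mathrm{d}t$, vanishes identically. (2) The Fourier transform $\mathcal{F}f$ of $f$ vanishes on $N(D)$. In particular, the X-ray transform with directions restricted to $D$, $f\mapsto(R_vf)_{v\in D}$, is injective on $\mathcal{S}(\mathbb{R}^n)$ if and only if $N(D)$ is dense in $\mathbb{R}^n$.
   Context: $\mathcal{S}(\mathbb{R}^n)$ is the space of complex-valued Schwartz functions, and $\mathcal{F}f(k)=\int_{\mathbb{R}^n}e^{-ik\cdot y}f(y)\,\mathrm{d}y$. No assumption is made on the set $D$. *)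

theory Defs
  imports "HOL-Analysis.Analysis"
begin

definition partial_deriv :: "'n::finite \<Rightarrow> (real^'n \<Rightarrow> complex) \<Rightarrow> real^'n \<Rightarrow> complex" where
  "partial_deriv i f x = vector_derivative (\<lambda>t::real. f (x + t *\<^sub>R axis i 1)) (at 0)"

text \<open>Iterated partial derivatives are indexed by the list of differentiation directions,
  so that each multi-index corresponds to the lists with the given multiplicities.\<close>

primrec iter_partial :: "'n::finite list \<Rightarrow> (real^'n \<Rightarrow> complex) \<Rightarrow> real^'n \<Rightarrow> complex" where
  "iter_partial [] f = f"
| "iter_partial (i # is) f = partial_deriv i (iter_partial is f)"

text \<open>\<open>vector_derivative\<close> is a total function with an unspecified value where the derivative
  does not exist. The following condition makes all iterated partial derivatives exist;
  as they are then all differentiable, they are continuous, so this is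
  smoothness in the usual sense.\<close>

definition smooth_fun :: "(real^'n::finite \<Rightarrow> complex) \<Rightarrow> bool" where
  "smooth_fun f \<longleftrightarrow> (\<forall>is. iter_partial is f differentiable_on UNIV)"

definition schwartz_space :: "(real^'n::finite \<Rightarrow> complex) set" where
  "schwartz_space = {f. smooth_fun f \<and>
     (\<forall>(\<alpha> :: 'n \<Rightarrow> nat) is. bounded (range (\<lambda>x. (\<Prod>i\<in>UNIV. (x $ i) ^ \<alpha> i) *\<^sub>R iter_partial is f x)))}"

definition fourier_transform :: "(real^'n::finite \<Rightarrow> complex) \<Rightarrow> real^'n \<Rightarrow> complex" where
  "fourier_transform f k = (LINT y|lborel. exp (- \<i> * complex_of_real (k \<bullet> y)) * f y)"

definition xray :: "real^'n::finite \<Rightarrow> (real^'n \<Rightarrow> complex) \<Rightarrow> real^'n \<Rightarrow> complex" where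
  "xray v f x = (LINT t|lborel. f (x + t *\<^sub>R v))"

definition restricted_xray ::
    "(real^'n::finite) set \<Rightarrow> (real^'n \<Rightarrow> complex) \<Rightarrow> real^'n \<Rightarrow> real^'n \<Rightarrow> complex" where
  "restricted_xray D f = restrict (\<lambda>v. xray v f) D"

definition normal_set :: "(real^'n::finite) set \<Rightarrow> (real^'n) set" where
  "normal_set D = {x. \<exists>v\<in>D. x \<bullet> v = 0}"

end

theory Submission
  imports Defs "HOL-Probability.Probability"
begin

text \<open>
  For a unit vector \<open>v\<close>, an integrable weight \<open>G\<close> on the line and an integrable \<open>g\<close>, Fubini and
  translation invariance give \<open>\<integral> G (x \<bullet> v) R\<^sub>v g x dx = (\<integral> G) (\<integral> g)\<close>, which replaces integration over the
  hyperplane orthogonal to \<open>v\<close>. Applied to modulated functions it shows that the Fourier transform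
  of \<open>G (x \<bullet> v) R\<^sub>v f x\<close> at \<open>k\<close> is the transform of \<open>G\<close> at \<open>k \<bullet> v\<close> times \<open>\<F> f\<close> at the projection of \<open>k\<close>
  to the hyperplane. With a Gaussian \<open>G\<close>, injectivity of the Fourier transform turns this into the
  equivalence. If \<open>N(D)\<close> misses a ball, the Fourier transform of a bump function supported
  in the reflected ball lies in the kernel of the restricted X-ray transform.
\<close>

section \<open>Lebesgue integrals on Euclidean spaces\<close>

lemma
  fixes f :: "'a::euclidean_space \<Rightarrow> 'b::{banach, second_countable_topology}"
  assumes c: "c \<noteq> 0"
  shows lborel_integrable_affine_iff: "integrable lborel (\<lambda>x. f (t + c *\<^sub>R x)) \<longleftrightarrow> integrable lborel f"
    and lborel_integral_affine:
      "(\<integral>x. f x \<partial>lborel) = \<bar>c\<bar> ^ DIM('a) *\<^sub>R (\<integral>x. f (t + c *\<^sub>R x) \<partial>lborel)"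
proof -
  have *: "integrable lborel (\<lambda>x. g (t + c *\<^sub>R x))" if g: "integrable lborel g" and c: "c \<noteq> 0"
    for t c and g :: "'a \<Rightarrow> 'b"
  proof -
    have [measurable]: "g \<in> borel_measurable borel"
      using borel_measurable_integrable[OF g] by simp
    have "integrable (density (distr lborel borel (\<lambda>x. t + c *\<^sub>R x)) (\<lambda>_. ennreal (\<bar>c\<bar> ^ DIM('a)))) g"
      using g by (subst (asm) lborel_affine[OF c, of t]) (simp add: ennreal_power[symmetric])
    then have "integrable lborel (\<lambda>x. \<bar>c\<bar> ^ DIM('a) *\<^sub>R g (t + c *\<^sub>R x))"
      by (subst (asm) integrable_density) (auto simp: integrable_distr_eq)
    from integrable_scaleR_right[OF this, of "1 / \<bar>c\<bar> ^ DIM('a)"] show ?thesis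
      using c by simp
  qed
  \<comment> \<open>The inverse affine substitution, so that the implication \<open>*\<close> gives
    both directions of the equivalence.\<close>
  have eq: "1 / c \<noteq> 0" "(\<lambda>x. f (t + c *\<^sub>R (- (1 / c) *\<^sub>R t + (1 / c) *\<^sub>R x))) = f"
    using c by (auto simp: algebra_simps)
  show iff: "integrable lborel (\<lambda>x. f (t + c *\<^sub>R x)) \<longleftrightarrow> integrable lborel f"
    using *[of f c t] c *[of "\<lambda>x. f (t + c *\<^sub>R x)" "1 / c" "- (1 / c) *\<^sub>R t"] eq by auto
  show "(\<integral>x. f x \<partial>lborel) = \<bar>c\<bar> ^ DIM('a) *\<^sub>R (\<integral>x. f (t + c *\<^sub>R x) \<partial>lborel)"
  proof (cases "integrable lborel f")
    case True
    then have [measurable]: "f \<in> borel_measurable borel"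
      using borel_measurable_integrable by force
    have "(\<integral>x. f x \<partial>lborel) =
        (\<integral>x. f x \<partial>density (distr lborel borel (\<lambda>x. t + c *\<^sub>R x)) (\<lambda>_. ennreal (\<bar>c\<bar> ^ DIM('a))))"
      by (subst lborel_affine[OF c, of t]) (simp add: ennreal_power[symmetric])
    also have "\<dots> = \<bar>c\<bar> ^ DIM('a) *\<^sub>R (\<integral>x. f (t + c *\<^sub>R x) \<partial>lborel)"
      by (subst integral_density) (auto simp: integral_distr)
    finally show ?thesis .
  next
    case False
    \<comment> \<open>Neither integrand is integrable here, and both Bochner integrals take the
      default value 0.\<close>
    with iff show ?thesis by (simp add: not_integrable_integral_eq)
  qed
qed

lemmas lborel_integrable_translation_iff = lborel_integrable_affine_iff[of 1, simplified]
  and lborel_integral_translation = lborel_integral_affine[of 1, simplified]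

text \<open>By \<open>lborel_eq\<close>, the basis coordinates carry the product of one-dimensional
  Lebesgue measures to \<open>lborel\<close>, so the product formula for
  \<open>product_sigma_finite\<close> measures applies.\<close>

lemma
  fixes f :: "'a::euclidean_space \<Rightarrow> real \<Rightarrow> 'b::{real_normed_field, banach, second_countable_topology}"
  assumes f: "\<And>b. b \<in> Basis \<Longrightarrow> integrable lborel (f b)"
  shows lborel_integrable_prod: "integrable lborel (\<lambda>x. \<Prod>b\<in>Basis. f b (x \<bullet> b))"
    and lborel_integral_prod:
      "(\<integral>x. (\<Prod>b\<in>Basis. f b (x \<bullet> b)) \<partial>lborel) = (\<Prod>b\<in>Basis. \<integral>x. f b x \<partial>lborel)"
proof -
  interpret product_sigma_finite "\<lambda>_::'a. lborel :: real measure" ..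
  have [measurable]: "f b \<in> borel_measurable borel" if "b \<in> Basis" for b
    using borel_measurable_integrable[OF f[OF that]] by simp
  have eq: "(\<Sum>b\<in>Basis. x b *\<^sub>R b) \<bullet> c = x c" if "c \<in> Basis" for x and c :: 'a
    using that by simp
  have P: "(\<lambda>x. \<Prod>b\<in>Basis. f b ((\<Sum>b\<in>Basis. x b *\<^sub>R b) \<bullet> b)) = (\<lambda>x. \<Prod>b\<in>Basis. f b (x b))"
    by (intro ext prod.cong refl) (simp add: eq)
  show "integrable lborel (\<lambda>x. \<Prod>b\<in>Basis. f b (x \<bullet> b))"
    by (subst lborel_eq, subst integrable_distr_eq)
       (auto simp only: P product_integrable_prod[OF finite_Basis f], measurable)
  show "(\<integral>x. (\<Prod>b\<in>Basis. f b (x \<bullet> b)) \<partial>lborel) = (\<Prod>b\<in>Basis. \<integral>x. f b x \<partial>lborel)"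
    by (subst lborel_eq, subst integral_distr)
       (auto simp only: P product_integral_prod[OF finite_Basis f], measurable)
qed

section \<open>Fourier transforms of Gaussians\<close>

lemma
  fixes s :: real
  shows integrable_gaussian_real: "integrable lborel (\<lambda>u::real. exp (- \<i> * of_real (s * u)) * of_real (exp (- (u\<^sup>2 / 2))))"
    and integral_gaussian_real: "(\<integral>u. exp (- \<i> * of_real (s * u :: real)) * of_real (exp (- (u\<^sup>2 / 2))) \<partial>lborel)
      = of_real (sqrt (2 * pi) * exp (- s\<^sup>2 / 2))"
proof -
  \<comment> \<open>Up to the normalising constant this is the standard normal density times a
    phase, so its integral is the characteristic function at \<open>- s\<close>.\<close>
  have eq: "(\<lambda>u::real. exp (- \<i> * of_real (s * u)) * of_real (exp (- (u\<^sup>2 / 2)))) =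
     (\<lambda>u. of_real (sqrt (2 * pi)) * (of_real (std_normal_density u) * iexp (- s * u)))"
    by (auto simp: std_normal_density_def fun_eq_iff )
  have "integrable lborel (\<lambda>u. std_normal_density u)"
    using integrable_std_normal_moment[of 0] by simp
  then have *: "integrable lborel (\<lambda>u. of_real (std_normal_density u) * iexp (- s * u) :: complex)"
    by (rule Bochner_Integration.integrable_bound) (auto simp: norm_mult)
  then show "integrable lborel (\<lambda>u::real. exp (- \<i> * of_real (s * u)) * of_real (exp (- (u\<^sup>2 / 2))))"
    unfolding eq by simp
  have "(\<integral>u. of_real (std_normal_density u) * iexp (- s * u) \<partial>lborel) = char std_normal_distribution (- s)"
    unfolding char_def by (subst integral_density) (auto simp: normal_density_nonneg scaleR_conv_of_real)
  then show "(\<integral>u. exp (- \<i> * of_real (s * u :: real)) * of_real (exp (- (u\<^sup>2 / 2))) \<partial>lborel)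
      = of_real (sqrt (2 * pi) * exp (- s\<^sup>2 / 2))"
    unfolding eq char_std_normal_distribution by simp
qed

text \<open>The inner product and the squared norm are sums over \<open>Basis\<close>, so the
  integrand factors into the one-dimensional case.\<close>

lemma
  fixes x :: "'a::euclidean_space"
  shows integrable_gaussian:
      "integrable lborel (\<lambda>k. exp (- \<i> * of_real (x \<bullet> k)) * of_real (exp (- ((norm k)\<^sup>2 / 2))))" (is ?I)
    and integral_gaussian:
      "(\<integral>k. exp (- \<i> * of_real (x \<bullet> k)) * of_real (exp (- ((norm k)\<^sup>2 / 2))) \<partial>lborel)
        = of_real (sqrt (2 * pi) ^ DIM('a) * exp (- (norm x)\<^sup>2 / 2))" (is ?E)
proof -
  let ?f = "\<lambda>b u. exp (- \<i> * of_real ((x \<bullet> b) * u)) * of_real (exp (- (u\<^sup>2 / 2))) :: complex"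
  have n: "(norm k)\<^sup>2 = (\<Sum>b\<in>Basis. (k \<bullet> b)\<^sup>2)" for k :: 'a
    unfolding power2_norm_eq_inner by (subst euclidean_inner) (simp add: power2_eq_square)
  have eq: "(\<lambda>k::'a. exp (- \<i> * of_real (x \<bullet> k)) * of_real (exp (- ((norm k)\<^sup>2 / 2)))) =
      (\<lambda>k. \<Prod>b\<in>Basis. ?f b (k \<bullet> b))"
    unfolding n by (subst euclidean_inner)
      (auto simp: fun_eq_iff prod.distrib exp_sum sum_distrib_left sum_divide_distrib sum_negf[symmetric])
  show ?I unfolding eq by (intro lborel_integrable_prod integrable_gaussian_real)
  show ?E unfolding eq
    by (subst lborel_integral_prod[OF integrable_gaussian_real], unfold integral_gaussian_real)
      (simp add: prod.distrib n exp_sum sum_divide_distrib sum_negf[symmetric])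
qed

lemma norm_exp_minus_i [simp]: "norm (exp (- \<i> * of_real t)) = 1" "norm (exp (- (\<i> * of_real t))) = 1"
  using norm_exp_i_times[of "- t"] by simp_all

section \<open>Fourier inversion\<close>

lemma integrable_modulate:
  fixes f :: "'a::euclidean_space \<Rightarrow> complex"
  assumes "integrable lborel f"
  shows "integrable lborel (\<lambda>y. exp (- \<i> * of_real (k \<bullet> y)) * f y)"
  by (rule Bochner_Integration.integrable_bound[OF assms])
    (use borel_measurable_integrable[OF assms] in \<open>auto simp: norm_mult\<close>)

lemma continuous_on_fourier_transform:
  fixes f :: "real^'n \<Rightarrow> complex"
  assumes f: "integrable lborel f"
  shows "continuous_on UNIV (fourier_transform f)"
  unfolding continuous_on_sequentially
proof safe
  fix s :: "nat \<Rightarrow> real^'n" and a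
  assume s: "s \<longlonglongrightarrow> a"
  have [measurable]: "f \<in> borel_measurable borel"
    using borel_measurable_integrable[OF f] by simp
  show "(fourier_transform f \<circ> s) \<longlonglongrightarrow> fourier_transform f a"
    unfolding comp_def fourier_transform_def
  proof (rule integral_dominated_convergence)
    show "integrable lborel (\<lambda>y. norm (f y))" using f by simp
    show "AE y in lborel. (\<lambda>n. exp (- \<i> * complex_of_real (s n \<bullet> y)) * f y) \<longlonglongrightarrow> exp (- \<i> * complex_of_real (a \<bullet> y)) * f y"
      by (intro AE_I2 tendsto_intros s)
  qed (auto simp: norm_mult)
qed

text \<open>The Gaussian weight makes the double integral absolutely convergent, so the order of
  integration may be exchanged. The inner integral over \<open>k\<close> is then a Gaussian of width
  \<open>e\<close>, which averages \<open>f\<close> around \<open>- x\<close>.\<close>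

lemma fourier_transform_gaussian_mean:
  fixes f :: "real^'n \<Rightarrow> complex"
  assumes f: "integrable lborel f" and e: "e > 0"
  shows "(\<integral>k. exp (- \<i> * of_real (x \<bullet> k)) * of_real (exp (- ((norm (e *\<^sub>R k))\<^sup>2 / 2))) * fourier_transform f k \<partial>lborel)
    = of_real (sqrt (2 * pi) ^ CARD('n)) * (\<integral>z. f (- x + e *\<^sub>R z) * of_real (exp (- ((norm z)\<^sup>2 / 2))) \<partial>lborel)"
proof -
  let ?g = "\<lambda>k::real^'n. of_real (exp (- ((norm (e *\<^sub>R k))\<^sup>2 / 2))) :: complex"
  let ?P = "\<lambda>(k, y). (exp (- \<i> * of_real ((x + y) \<bullet> k)) * ?g k) * f y"
  have [measurable]: "f \<in> borel_measurable borel"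
    using borel_measurable_integrable[OF f] by simp
  have gauss: "(\<integral>k. exp (- \<i> * of_real (w \<bullet> k)) * ?g k \<partial>lborel)
      = of_real ((1 / e) ^ CARD('n) * (sqrt (2 * pi) ^ CARD('n) * exp (- (norm ((1 / e) *\<^sub>R w))\<^sup>2 / 2)))"
    for w :: "real^'n"
  proof -
    have "(\<integral>k. exp (- \<i> * of_real (w \<bullet> k)) * ?g k \<partial>lborel)
      = \<bar>1 / e\<bar> ^ CARD('n) *\<^sub>R (\<integral>k. exp (- \<i> * of_real (((1 / e) *\<^sub>R w) \<bullet> k)) *
          of_real (exp (- ((norm k)\<^sup>2 / 2))) \<partial>lborel)"
      using e by (subst lborel_integral_affine[of "1 / e" _ 0]) auto
    then show ?thesis
      unfolding integral_gaussian using e by (simp add: scaleR_conv_of_real)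
  qed
  have g: "integrable lborel ?g"
    using integrable_gaussian[of "0::real^'n"] e
      lborel_integrable_affine_iff[of e "\<lambda>k::real^'n. of_real (exp (- ((norm k)\<^sup>2 / 2))) :: complex" 0]
    by simp
  \<comment> \<open>The phase has norm 1, so this product of norms dominates
    \<open>?P\<close>.\<close>
  have "integrable (lborel \<Otimes>\<^sub>M lborel) (\<lambda>p. norm (?g (fst p)) * norm (f (snd p)))"
  proof (rule lborel_pair.Fubini_integrable)
    show "integrable lborel (\<lambda>k. \<integral>y. norm (norm (?g (fst (k, y))) * norm (f (snd (k, y)))) \<partial>lborel)"
      using integrable_norm[OF g] by (simp add: norm_mult)
  qed (use f in auto)
  then have P: "integrable (lborel \<Otimes>\<^sub>M lborel) ?P"
    by (rule Bochner_Integration.integrable_bound) (auto simp: norm_mult)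
  have "(\<integral>k. exp (- \<i> * of_real (x \<bullet> k)) * ?g k * fourier_transform f k \<partial>lborel) =
      (\<integral>k. (\<integral>y. ?P (k, y) \<partial>lborel) \<partial>lborel)"
    unfolding fourier_transform_def
    by (subst integral_mult_right_zero[symmetric])
      (auto simp: inner_add_left inner_commute algebra_simps exp_add[symmetric] intro!: Bochner_Integration.integral_cong)
  also have "\<dots> = (\<integral>y. (\<integral>k. ?P (k, y) \<partial>lborel) \<partial>lborel)"
    using P by (subst lborel_pair.Fubini_integral) auto
  also have "\<dots> = (\<integral>y. of_real ((1 / e) ^ CARD('n) * (sqrt (2 * pi) ^ CARD('n) * exp (- (norm ((1 / e) *\<^sub>R (x + y)))\<^sup>2 / 2))) * f y \<partial>lborel)"
    by (simp only: prod.case integral_mult_left_zero gauss)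
  \<comment> \<open>Substitution \<open>y = - x + e *\<^sub>R z\<close>; its Jacobian
    \<open>e ^ CARD('n)\<close> will cancel the factor \<open>(1 / e) ^ CARD('n)\<close> from
    \<open>gauss\<close>.\<close>
  also have "\<dots> = \<bar>e\<bar> ^ CARD('n) *\<^sub>R (\<integral>z. of_real ((1 / e) ^ CARD('n) * (sqrt (2 * pi) ^ CARD('n) * exp (- (norm z)\<^sup>2 / 2))) * f (- x + e *\<^sub>R z) \<partial>lborel)"
    using e by (subst lborel_integral_affine[of e _ "- x"]) auto
  also have "(\<lambda>z. of_real ((1 / e) ^ CARD('n) * (sqrt (2 * pi) ^ CARD('n) * exp (- (norm z)\<^sup>2 / 2))) * f (- x + e *\<^sub>R z)) =
      (\<lambda>z. of_real ((1 / e) ^ CARD('n)) * (of_real (sqrt (2 * pi) ^ CARD('n)) * (f (- x + e *\<^sub>R z) * of_real (exp (- ((norm z)\<^sup>2 / 2))))))"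
    by (simp add: fun_eq_iff)
  also have "\<bar>e\<bar> ^ CARD('n) *\<^sub>R (\<integral>z. of_real ((1 / e) ^ CARD('n)) * (of_real (sqrt (2 * pi) ^ CARD('n)) * (f (- x + e *\<^sub>R z) * of_real (exp (- ((norm z)\<^sup>2 / 2))))) \<partial>lborel) =
      of_real (sqrt (2 * pi) ^ CARD('n)) * (\<integral>z. f (- x + e *\<^sub>R z) * of_real (exp (- ((norm z)\<^sup>2 / 2))) \<partial>lborel)"
    unfolding integral_mult_right_zero using e by (simp add: scaleR_conv_of_real power_divide)
  finally show ?thesis .
qed

text \<open>Both sides of \<open>fourier_transform_gaussian_mean\<close> converge as the width tends
  to 0. Dominated convergence uses integrability of the transform on the left, and continuity and
  boundedness of \<open>f\<close> on the right.\<close>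

theorem fourier_transform_fourier_transform:
  fixes f :: "real^'n \<Rightarrow> complex"
  assumes f: "integrable lborel f" and cont: "continuous_on UNIV f" and bdd: "bounded (range f)"
    and F: "integrable lborel (fourier_transform f)"
  shows "fourier_transform (fourier_transform f) x = of_real ((2 * pi) ^ CARD('n)) * f (- x)"
proof (rule LIMSEQ_unique)
  \<comment> \<open>The successor keeps every width positive, as
    \<open>fourier_transform_gaussian_mean\<close> demands.\<close>
  let ?e = "\<lambda>n::nat. 1 / real (Suc n)"
  have [measurable]: "fourier_transform f \<in> borel_measurable borel"
    using borel_measurable_integrable[OF F] by simp
  let ?L = "\<lambda>n. (\<integral>k. exp (- \<i> * of_real (x \<bullet> k)) * of_real (exp (- ((norm (?e n *\<^sub>R k))\<^sup>2 / 2))) * fourier_transform f k \<partial>lborel)"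
  have [measurable]: "f \<in> borel_measurable borel"
    using borel_measurable_integrable[OF f] by simp
  have e: "?e \<longlonglongrightarrow> 0" by (rule lim_1_over_n[THEN LIMSEQ_Suc])
  have lim0: "(\<lambda>n. a n *\<^sub>R k) \<longlonglongrightarrow> 0" if "a \<longlonglongrightarrow> (0::real)" for a and k :: "real^'n"
    using tendsto_scaleR[OF that tendsto_const[of k]] by simp
  have "?L \<longlonglongrightarrow> (\<integral>k. exp (- \<i> * of_real (x \<bullet> k)) * of_real (exp (- ((norm (0::real^'n))\<^sup>2 / 2))) * fourier_transform f k \<partial>lborel)"
  proof (rule integral_dominated_convergence[where w="\<lambda>k. norm (fourier_transform f k)"])
    show "AE k in lborel. (\<lambda>n. exp (- \<i> * of_real (x \<bullet> k)) * of_real (exp (- ((norm (?e n *\<^sub>R k))\<^sup>2 / 2))) * fourier_transform f k)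
       \<longlonglongrightarrow> exp (- \<i> * of_real (x \<bullet> k)) * of_real (exp (- ((norm (0::real^'n))\<^sup>2 / 2))) * fourier_transform f k"
      by (intro AE_I2 tendsto_intros lim0[OF e]) auto
    show "AE k in lborel. norm (exp (- \<i> * of_real (x \<bullet> k)) * of_real (exp (- ((norm (?e n *\<^sub>R k))\<^sup>2 / 2))) * fourier_transform f k)
      \<le> norm (fourier_transform f k)" for n
      by (intro AE_I2) (auto simp: norm_mult intro!: mult_left_le_one_le)
  qed (use F in auto)
  then show "?L \<longlonglongrightarrow> fourier_transform (fourier_transform f) x"
    by (simp add: fourier_transform_def[of "fourier_transform f"])
  have L: "?L = (\<lambda>n. of_real (sqrt (2 * pi) ^ CARD('n)) * (\<integral>z. f (- x + ?e n *\<^sub>R z) * of_real (exp (- ((norm z)\<^sup>2 / 2))) \<partial>lborel))"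
    by (intro ext fourier_transform_gaussian_mean[OF f]) simp
  obtain B where B: "\<And>x. norm (f x) \<le> B"
    using bdd by (auto simp: bounded_iff)
  have gauss: "integrable lborel (\<lambda>z::real^'n. of_real (exp (- ((norm z)\<^sup>2 / 2))) :: complex)"
     "(\<integral>z. of_real (exp (- ((norm (z::real^'n))\<^sup>2 / 2))) \<partial>lborel) = complex_of_real (sqrt (2 * pi) ^ CARD('n))"
    using integrable_gaussian[of "0::real^'n"] integral_gaussian[of "0::real^'n"] by simp_all
  have "(\<lambda>n. \<integral>z. f (- x + ?e n *\<^sub>R z) * of_real (exp (- ((norm z)\<^sup>2 / 2))) \<partial>lborel) \<longlonglongrightarrow>
      (\<integral>z. f (- x + 0) * of_real (exp (- ((norm (z::real^'n))\<^sup>2 / 2))) \<partial>lborel)"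
  proof (rule integral_dominated_convergence[where w="\<lambda>z. B * norm (of_real (exp (- ((norm z)\<^sup>2 / 2))) :: complex)"])
    show "AE z in lborel. (\<lambda>n. f (- x + ?e n *\<^sub>R z) * of_real (exp (- ((norm z)\<^sup>2 / 2)))) \<longlonglongrightarrow>
       f (- x + 0) * of_real (exp (- ((norm z)\<^sup>2 / 2)))"
      by (intro AE_I2 tendsto_intros continuous_on_tendsto_compose[OF cont] lim0[OF e]) auto
    show "integrable lborel (\<lambda>z::real^'n. B * norm (of_real (exp (- ((norm z)\<^sup>2 / 2))) :: complex))"
      using gauss(1) by (intro integrable_mult_right integrable_norm)
    show "AE z in lborel. norm (f (- x + ?e n *\<^sub>R z) * of_real (exp (- ((norm z)\<^sup>2 / 2))))
      \<le> B * norm (of_real (exp (- ((norm z)\<^sup>2 / 2))) :: complex)" for n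
      unfolding norm_mult by (intro AE_I2 mult_right_mono B) auto
  qed auto
  then have "(\<lambda>n. \<integral>z. f (- x + ?e n *\<^sub>R z) * of_real (exp (- ((norm z)\<^sup>2 / 2))) \<partial>lborel) \<longlonglongrightarrow>
      f (- x) * of_real (sqrt (2 * pi) ^ CARD('n))"
    by (simp only: integral_mult_right_zero gauss(2) add_0_right)
  from tendsto_mult[OF tendsto_const this]
  have "?L \<longlonglongrightarrow> of_real (sqrt (2 * pi) ^ CARD('n)) * (f (- x) * of_real (sqrt (2 * pi) ^ CARD('n)))"
    unfolding L .
  moreover have "complex_of_real (sqrt (2 * pi) ^ CARD('n)) * (f (- x) * of_real (sqrt (2 * pi) ^ CARD('n)))
     = of_real ((sqrt (2 * pi) * sqrt (2 * pi)) ^ CARD('n)) * f (- x)"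
    by (simp only: power_mult_distrib of_real_mult mult_ac)
  moreover have "sqrt (2 * pi) * sqrt (2 * pi) = 2 * pi"
    by simp
  ultimately show "?L \<longlonglongrightarrow> of_real ((2 * pi) ^ CARD('n)) * f (- x)"
    by (simp only:)
qed

text \<open>The zero transform is integrable, so inversion applies at \<open>- x\<close>.\<close>

corollary fourier_transform_eq_0D:
  fixes f :: "real^'n \<Rightarrow> complex"
  assumes "integrable lborel f" "continuous_on UNIV f" "bounded (range f)" "\<And>k. fourier_transform f k = 0"
  shows "f x = 0"
proof -
  have F: "fourier_transform f = (\<lambda>_. 0)"
    using assms(4) by auto
  have "of_real ((2 * pi) ^ CARD('n)) * f (- (- x)) = 0"
    by (subst fourier_transform_fourier_transform[OF assms(1-3), symmetric]) (simp_all add: F, simp add: fourier_transform_def)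
  then show ?thesis by simp
qed

section \<open>Schwartz functions\<close>

text \<open>Differentiability rules out the unspecified value of \<open>vector_derivative\<close>;
  the chain rule along the coordinate line then reduces partial derivatives to the Frechet
  derivative.\<close>

lemma partial_deriv_eq:
  assumes "(f has_derivative f') (at x)"
  shows "partial_deriv i f x = f' (axis i 1)"
proof -
  have "((\<lambda>t. f (x + t *\<^sub>R axis i 1)) has_derivative (\<lambda>t. f' (t *\<^sub>R axis i 1))) (at 0)"
    by (rule has_derivative_compose[where g=f, of "\<lambda>t. x + t *\<^sub>R axis i 1"])
      (use assms in \<open>auto intro!: derivative_eq_intros\<close>)
  then have "((\<lambda>t. f (x + t *\<^sub>R axis i 1)) has_vector_derivative f' (axis i 1)) (at 0)"
    unfolding has_vector_derivative_def
    by (simp add: linear_cmul[OF has_derivative_linear[OF assms]])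
  then show ?thesis
    unfolding partial_deriv_def by (rule vector_derivative_at)
qed

lemma iter_partial_diff:
  assumes "smooth_fun f" "smooth_fun g"
  shows "iter_partial is (\<lambda>x. f x - g x) = (\<lambda>x. iter_partial is f x - iter_partial is g x)"
proof (induction "is")
  case (Cons i "is")
  show ?case
  proof
    fix x
    obtain f' g' where *: "(iter_partial is f has_derivative f') (at x)" "(iter_partial is g has_derivative g') (at x)"
      using assms by (force simp: smooth_fun_def differentiable_on_def differentiable_def)
    show "iter_partial (i # is) (\<lambda>x. f x - g x) x = iter_partial (i # is) f x - iter_partial (i # is) g x"
      using partial_deriv_eq[OF *(1)] partial_deriv_eq[OF *(2)]
        partial_deriv_eq[OF has_derivative_diff[OF *]] by (simp add: Cons)
  qed
qed simp

lemma schwartz_space_diff: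
  assumes f: "f \<in> schwartz_space" and g: "g \<in> schwartz_space"
  shows "(\<lambda>x. f x - g x) \<in> schwartz_space"
proof -
  have "smooth_fun f" "smooth_fun g"
    using f g by (auto simp: schwartz_space_def)
  note eq = iter_partial_diff[OF this]
  have "bounded (range (\<lambda>x. (\<Prod>i\<in>UNIV. (x $ i) ^ \<alpha> i) *\<^sub>R (iter_partial is f x - iter_partial is g x)))" for \<alpha> "is"
    unfolding scaleR_diff_right
    by (rule bounded_minus_comp) (use f g in \<open>auto simp: schwartz_space_def\<close>)
  moreover have "smooth_fun (\<lambda>x. f x - g x)"
    using f g by (auto simp: schwartz_space_def smooth_fun_def eq)
  ultimately show ?thesis
    by (auto simp: schwartz_space_def eq)
qed

lemma zero_in_schwartz_space: "(\<lambda>_::real^'n::finite. 0) \<in> schwartz_space"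
proof -
  have "iter_partial is (\<lambda>_. 0) = (\<lambda>_. 0)" for "is" :: "'n::finite list"
    by (induction "is") (auto simp: partial_deriv_def)
  then show ?thesis
    by (auto simp: schwartz_space_def smooth_fun_def)
qed

lemma continuous_on_schwartz:
  assumes "f \<in> schwartz_space" shows "continuous_on S f"
proof -
  have "iter_partial [] f differentiable_on UNIV"
    using assms unfolding schwartz_space_def smooth_fun_def by blast
  then show ?thesis
    using differentiable_imp_continuous_on continuous_on_subset by fastforce
qed

lemma borel_measurable_schwartz: "f \<in> schwartz_space \<Longrightarrow> f \<in> borel_measurable borel"
  by (intro borel_measurable_continuous_onI continuous_on_schwartz)

text \<open>The weight is chosen because its inverse is a product of integrable functions of one
  coordinate. The exponents \<open>\<alpha>\<close> vary in the induction: a new factor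
  \<open>1 + (x $ j)\<^sup>2\<close> costs the bound for \<open>\<alpha>\<close> plus the bound with
  the exponent at \<open>j\<close> raised by 2.\<close>

lemma schwartz_weight_bound:
  fixes f :: "real^'n \<Rightarrow> complex"
  assumes f: "f \<in> schwartz_space" and "finite S"
  shows "\<exists>C. \<forall>x. norm ((\<Prod>i\<in>UNIV. (x $ i) ^ \<alpha> i) *\<^sub>R f x) * (\<Prod>i\<in>S. 1 + (x $ i)\<^sup>2) \<le> C"
  using \<open>finite S\<close>
proof (induction S arbitrary: \<alpha>)
  case empty
  have "bounded (range (\<lambda>x. (\<Prod>i\<in>UNIV. (x $ i) ^ \<alpha> i) *\<^sub>R iter_partial [] f x))"
    using f unfolding schwartz_space_def by blast
  then show ?case by (auto simp: bounded_iff)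
next
  case (insert j S)
  let ?\<beta> = "\<alpha>(j := \<alpha> j + 2)"
  have pow: "(\<Prod>i\<in>UNIV. (x $ i) ^ ?\<beta> i) = (x $ j)\<^sup>2 * (\<Prod>i\<in>UNIV. (x $ i) ^ \<alpha> i)" for x :: "real^'n"
  proof -
    have "(\<Prod>i\<in>UNIV. (x $ i) ^ ?\<beta> i) = (\<Prod>i\<in>UNIV. (if i = j then (x $ j)\<^sup>2 else 1) * (x $ i) ^ \<alpha> i)"
      by (intro prod.cong) (auto simp: power_add power2_eq_square)
    then show ?thesis by (simp add: prod.distrib)
  qed
  obtain C where C: "\<And>x. norm ((\<Prod>i\<in>UNIV. (x $ i) ^ \<alpha> i) *\<^sub>R f x) * (\<Prod>i\<in>S. 1 + (x $ i)\<^sup>2) \<le> C"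
    using insert.IH[of \<alpha>] by blast
  obtain D where D: "\<And>x. norm ((\<Prod>i\<in>UNIV. (x $ i) ^ ?\<beta> i) *\<^sub>R f x) * (\<Prod>i\<in>S. 1 + (x $ i)\<^sup>2) \<le> D"
    using insert.IH[of ?\<beta>] by blast
  have "norm ((\<Prod>i\<in>UNIV. (x $ i) ^ \<alpha> i) *\<^sub>R f x) * (\<Prod>i\<in>insert j S. 1 + (x $ i)\<^sup>2) \<le> C + D" for x
    using add_mono[OF C[of x] D[of x]] insert.hyps unfolding pow by (simp add: abs_mult ring_distribs mult_ac)
  then show ?case by blast
qed

lemma schwartz_prod_bound:
  fixes f :: "real^'n \<Rightarrow> complex"
  assumes "f \<in> schwartz_space"
  obtains C where "\<And>x. norm (f x) * (\<Prod>i\<in>UNIV. 1 + (x $ i)\<^sup>2) \<le> C"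
  using schwartz_weight_bound[OF assms finite, of "\<lambda>_. 0" UNIV] by auto

lemma prod_one_plus_pos: "(\<Prod>i\<in>A. 1 + (x $ i :: real)\<^sup>2) > 0"
  by (intro prod_pos) (auto intro: add_pos_nonneg)

lemma integrable_inverse_one_plus_square: "integrable lborel (\<lambda>x::real. inverse (1 + x\<^sup>2))"
  using integrable_inverse_1_plus_square
  by (simp add: set_integrable_def)

text \<open>The decay from \<open>schwartz_prod_bound\<close> is dominated by a product over
  coordinates, to which \<open>lborel_integrable_prod\<close> applies.\<close>

lemma integrable_schwartz:
  fixes f :: "real^'n \<Rightarrow> complex"
  assumes f: "f \<in> schwartz_space"
  shows "integrable lborel f"
proof -
  obtain C where C: "\<And>x. norm (f x) * (\<Prod>i\<in>UNIV. 1 + (x $ i)\<^sup>2) \<le> C"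
    using schwartz_prod_bound[OF f] by blast
  have B: "(Basis :: (real^'n) set) = (\<lambda>i. axis i 1) ` UNIV"
    by (auto simp: Basis_vec_def)
  have "integrable lborel (\<lambda>x::real^'n. C * (\<Prod>b\<in>Basis. inverse (1 + (x \<bullet> b)\<^sup>2)))"
    by (intro integrable_mult_right lborel_integrable_prod integrable_inverse_one_plus_square)
  then show ?thesis
  proof (rule Bochner_Integration.integrable_bound)
    have "(\<Prod>b\<in>Basis. inverse (1 + (x \<bullet> b)\<^sup>2)) = inverse (\<Prod>i\<in>UNIV. 1 + (x $ i)\<^sup>2)" for x :: "real^'n"
      unfolding B by (subst prod.reindex) (auto simp: inj_on_def axis_eq_axis inner_axis prod_inversef[symmetric] comp_def)
    moreover have "norm (f x) \<le> norm (C * inverse (\<Prod>i\<in>UNIV. 1 + (x $ i)\<^sup>2))" for x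
      proof -
      have "norm (f x) \<le> C * inverse (\<Prod>i\<in>UNIV. 1 + (x $ i)\<^sup>2)"
        using C[of x] prod_one_plus_pos[of x UNIV] by (simp add: field_simps)
      then show ?thesis by simp
    qed
    ultimately show "AE x in lborel. norm (f x) \<le> norm (C * (\<Prod>b\<in>Basis. inverse (1 + (x \<bullet> b)\<^sup>2)))"
      by simp
  qed (use borel_measurable_schwartz[OF f] in simp)
qed

text \<open>Both 1 and the sum of the squared coordinates are at most the product weight, which
  explains the factor 2 in the proof. A radial bound suits lines in arbitrary directions.\<close>

lemma schwartz_square_bound:
  fixes f :: "real^'n \<Rightarrow> complex"
  assumes f: "f \<in> schwartz_space"
  obtains C where "C \<ge> 0" "\<And>x. norm (f x) \<le> C * inverse (1 + (norm x)\<^sup>2)"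
proof -
  obtain C where C: "\<And>x. norm (f x) * (\<Prod>i\<in>UNIV. 1 + (x $ i)\<^sup>2) \<le> C"
    using schwartz_prod_bound[OF f] by blast
  have n: "norm (f x) * (1 + (norm x)\<^sup>2) \<le> 2 * C" for x
  proof -
    let ?P = "\<Prod>i\<in>UNIV. 1 + (x $ i)\<^sup>2"
    have "(\<Sum>i\<in>UNIV. (x $ i)\<^sup>2) = (norm x)\<^sup>2"
      unfolding power2_norm_eq_inner inner_vec_def by (simp add: power2_eq_square)
    moreover have "(\<Sum>i\<in>UNIV. (x $ i)\<^sup>2) \<le> ?P"
      by (rule sum_le_prod) auto
    moreover have "1 \<le> ?P"
      by (rule prod_ge_1) auto
    ultimately have "norm (f x) * (1 + (norm x)\<^sup>2) \<le> norm (f x) * (2 * ?P)"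
      by (intro mult_left_mono) auto
    then show ?thesis
      using C[of x] by simp
  qed
  show thesis
  proof
    \<comment> \<open>The bound at the origin forces the sign of the constant.\<close>
    show "2 * C \<ge> 0" by (rule order_trans[OF norm_ge_zero[of "f 0"]]) (use n[of 0] in simp)
    show "norm (f x) \<le> 2 * C * inverse (1 + (norm x)\<^sup>2)" for x
    proof -
      have "1 + (norm x)\<^sup>2 > 0" by (simp add: add_pos_nonneg)
      with n[of x] show ?thesis by (simp add: field_simps)
    qed
  qed
qed

lemma bounded_schwartz: assumes "f \<in> schwartz_space" shows "bounded (range f)"
proof -
  have "bounded (range (\<lambda>x. (\<Prod>i\<in>UNIV. (x $ i) ^ (0::nat)) *\<^sub>R iter_partial [] f x))"
    using assms unfolding schwartz_space_def mem_Collect_eq by (elim conjE allE)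
  then show ?thesis by simp
qed

section \<open>The X-ray transform\<close>

text \<open>Translate the line parameter by \<open>x \<bullet> v\<close>. For a unit vector this
  moves the base point into the orthogonal hyperplane, where the decay in \<open>t\<close> is
  uniform in \<open>x\<close>.\<close>

lemma xray_perp: "xray v f x = xray v f (x - (x \<bullet> v) *\<^sub>R v)"
  unfolding xray_def
  by (subst lborel_integral_translation[of _ "- (x \<bullet> v)"]) (simp add: algebra_simps)

text \<open>For fixed \<open>t\<close>, the translation \<open>y = x + t *\<^sub>R v\<close>
  preserves the measure and turns \<open>?Q\<close> into \<open>?P\<close>. Integrating
  \<open>?P\<close> first over \<open>t\<close> separates \<open>G\<close> from
  \<open>g\<close>.\<close>

lemma
  fixes g :: "real^'n \<Rightarrow> complex" and G :: "real \<Rightarrow> complex"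
  assumes v: "norm v = 1" and g: "integrable lborel g" and G: "integrable lborel G"
  shows integrable_xray: "integrable lborel (\<lambda>x. G (x \<bullet> v) * xray v g x)" (is ?I)
    and integral_xray: "(\<integral>x. G (x \<bullet> v) * xray v g x \<partial>lborel) = (\<integral>u. G u \<partial>lborel) * (\<integral>y. g y \<partial>lborel)" (is ?E)
proof -
  have vv: "v \<bullet> v = 1" using v by (simp add: dot_square_norm)
  have [measurable]: "g \<in> borel_measurable borel" "G \<in> borel_measurable borel"
    using borel_measurable_integrable[OF g] borel_measurable_integrable[OF G] by simp_all
  let ?P = "\<lambda>(y, t). G (y \<bullet> v - t) * g y" and ?Q = "\<lambda>(x, t). G (x \<bullet> v) * g (x + t *\<^sub>R v)"
  \<comment> \<open>Here \<open>v \<bullet> v = 1\<close> enters: \<open>x \<bullet> v\<close>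
    becomes \<open>y \<bullet> v - t\<close>.\<close>
  have PQ: "?Q (- t *\<^sub>R v + y, t) = ?P (y, t)" for y t
    by (simp add: inner_add_left inner_diff_left vv)
  have int_P: "integrable lborel (\<lambda>t. G (a - t))" "(\<integral>t. G (a - t) \<partial>lborel) = (\<integral>t. G t \<partial>lborel)" for a
    using lborel_integrable_affine_iff[of "-1" G a] lborel_integral_affine[of "-1" G a] G by auto
  have P: "integrable (lborel \<Otimes>\<^sub>M lborel) ?P"
  proof (rule lborel_pair.Fubini_integrable)
    have "(\<integral>t. norm (?P (y, t)) \<partial>lborel) = (\<integral>t. norm (G t) \<partial>lborel) * norm (g y)" for y
      using lborel_integral_affine[of "-1" "\<lambda>t. norm (G t)" "y \<bullet> v"] by (simp add: norm_mult)
    then show "integrable lborel (\<lambda>y. \<integral>t. norm (?P (y, t)) \<partial>lborel)"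
      using g by simp
    show "AE y in lborel. integrable lborel (\<lambda>t. ?P (y, t))"
      using int_P by simp
  qed measurable
  then have P': "integrable (lborel \<Otimes>\<^sub>M lborel) (\<lambda>(t, y). ?P (y, t))"
    by (subst lborel_pair.integrable_product_swap_iff)
  \<comment> \<open>The translation acts on the \<open>x\<close>-slices at fixed \<open>t\<close>,
    hence the swapped order of the variables.\<close>
  have "integrable (lborel \<Otimes>\<^sub>M lborel) (\<lambda>(t, x). ?Q (x, t))"
  proof (rule lborel_pair.Fubini_integrable)
    have "integrable lborel (\<lambda>t. \<integral>y. norm (?P (y, t)) \<partial>lborel)"
      using lborel_pair.integrable_fst'[OF integrable_norm[OF P']] by simp
    moreover have "(\<integral>y. norm (?P (y, t)) \<partial>lborel) = (\<integral>x. norm (?Q (x, t)) \<partial>lborel)" for t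
      using lborel_integral_translation[of "\<lambda>x. norm (?Q (x, t))" "- t *\<^sub>R v"] unfolding PQ by (rule sym)
    ultimately show "integrable lborel (\<lambda>t. \<integral>x. norm (case (t, x) of (t, x) \<Rightarrow> ?Q (x, t)) \<partial>lborel)"
      by simp
    have "AE t in lborel. integrable lborel (\<lambda>y. ?P (y, t))"
      using lborel_pair.AE_integrable_fst'[OF P'] by simp
    moreover have "integrable lborel (\<lambda>x. ?Q (x, t))" if "integrable lborel (\<lambda>y. ?P (y, t))" for t
    proof -
      have "integrable lborel (\<lambda>x. ?Q (- t *\<^sub>R v + x, t))"
        using that unfolding PQ .
      then show ?thesis
        using lborel_integrable_translation_iff[of "\<lambda>x. ?Q (x, t)" "- t *\<^sub>R v"] by blast
    qed
    ultimately show "AE t in lborel. integrable lborel (\<lambda>x. case (t, x) of (t, x) \<Rightarrow> ?Q (x, t))"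
      by auto
  qed measurable
  then have Q: "integrable (lborel \<Otimes>\<^sub>M lborel) ?Q"
    by (subst (asm) lborel_pair.integrable_product_swap_iff)
  have X: "(\<lambda>x. G (x \<bullet> v) * xray v g x) = (\<lambda>x. \<integral>t. ?Q (x, t) \<partial>lborel)"
    by (simp add: xray_def)
  show ?I unfolding X by (rule lborel_pair.integrable_fst'[OF Q])
  have "(\<integral>x. G (x \<bullet> v) * xray v g x \<partial>lborel) = (\<integral>t. \<integral>x. ?Q (x, t) \<partial>lborel \<partial>lborel)"
    unfolding X using Q by (subst lborel_pair.Fubini_integral) auto
  also have "\<dots> = (\<integral>t. \<integral>y. ?P (y, t) \<partial>lborel \<partial>lborel)"
  proof (rule Bochner_Integration.integral_cong[OF refl])
    show "(\<integral>x. ?Q (x, t) \<partial>lborel) = (\<integral>y. ?P (y, t) \<partial>lborel)" for t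
      using lborel_integral_translation[of "\<lambda>x. ?Q (x, t)" "- t *\<^sub>R v"] unfolding PQ .
  qed
  also have "\<dots> = (\<integral>y. \<integral>t. ?P (y, t) \<partial>lborel \<partial>lborel)"
    using P by (subst lborel_pair.Fubini_integral) auto
  also have "\<dots> = (\<integral>u. G u \<partial>lborel) * (\<integral>y. g y \<partial>lborel)"
    by (simp add: int_P)
  finally show ?E .
qed

context
  fixes f :: "real^'n \<Rightarrow> complex" and v :: "real^'n"
  assumes f: "f \<in> schwartz_space" and v: "norm v = 1"
begin

text \<open>After projection to the hyperplane, \<open>t\<close> is the component along
  \<open>v\<close>, so \<open>\<bar>t\<bar>\<close> is at most the norm of the point. The bound is
  free of \<open>x\<close> and serves as a common dominating function.\<close>

lemma schwartz_line_bound: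
  obtains C where "C \<ge> 0" "\<And>x t. norm (f (x - (x \<bullet> v) *\<^sub>R v + t *\<^sub>R v)) \<le> C * inverse (1 + t\<^sup>2)"
proof -
  obtain C where C: "C \<ge> 0" "\<And>x. norm (f x) \<le> C * inverse (1 + (norm x)\<^sup>2)"
    by (rule schwartz_square_bound[OF f]) blast
  have "norm (f (x - (x \<bullet> v) *\<^sub>R v + t *\<^sub>R v)) \<le> C * inverse (1 + t\<^sup>2)" for x t
  proof -
    let ?y = "x - (x \<bullet> v) *\<^sub>R v + t *\<^sub>R v"
    have "v \<bullet> v = 1" using v by (simp add: dot_square_norm)
    then have "?y \<bullet> v = t" by (simp add: inner_add_left inner_diff_left)
    then have "\<bar>t\<bar> \<le> norm ?y" using Cauchy_Schwarz_ineq2[of ?y v] v by simp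
    then have "t\<^sup>2 \<le> (norm ?y)\<^sup>2" by (metis abs_le_square_iff abs_norm_cancel)
    then have "inverse (1 + (norm ?y)\<^sup>2) \<le> inverse (1 + t\<^sup>2)"
      by (intro le_imp_inverse_le) (auto simp: add_pos_nonneg)
    then show ?thesis
      using C(2)[of ?y] mult_left_mono[OF _ C(1)] by (meson order_trans)
  qed
  with C(1) show thesis by (rule that)
qed

lemma integrable_schwartz_line: "integrable lborel (\<lambda>t. f (x + t *\<^sub>R v))"
proof -
  note borel_measurable_schwartz[OF f, measurable]
  obtain C where C: "\<And>x t. norm (f (x - (x \<bullet> v) *\<^sub>R v + t *\<^sub>R v)) \<le> C * inverse (1 + t\<^sup>2)"
    by (rule schwartz_line_bound) blast
  have "integrable lborel (\<lambda>t. f (x - (x \<bullet> v) *\<^sub>R v + t *\<^sub>R v))"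
    by (rule Bochner_Integration.integrable_bound[OF integrable_mult_right[OF integrable_inverse_one_plus_square, of C]])
      (use C order_trans[OF C abs_ge_self] in auto)
  then have "integrable lborel (\<lambda>t. f (x + (- (x \<bullet> v) + t) *\<^sub>R v))"
    by (simp add: algebra_simps)
  then show ?thesis
    using lborel_integrable_translation_iff[of "\<lambda>t. f (x + t *\<^sub>R v)" "- (x \<bullet> v)"] by simp
qed

lemma bounded_xray: "bounded (range (xray v f))"
proof -
  obtain C where C: "\<And>x t. norm (f (x - (x \<bullet> v) *\<^sub>R v + t *\<^sub>R v)) \<le> C * inverse (1 + t\<^sup>2)"
    by (rule schwartz_line_bound) blast
  have "norm (xray v f x) \<le> (\<integral>t. C * inverse (1 + t\<^sup>2) \<partial>lborel)" for x
    unfolding xray_perp[of v f x] unfolding xray_def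
    by (rule Bochner_Integration.integral_norm_bound_integral[OF integrable_schwartz_line
          integrable_mult_right[OF integrable_inverse_one_plus_square]]) (rule C)
  then show ?thesis by (auto simp: bounded_iff)
qed

lemma continuous_on_xray: "continuous_on UNIV (xray v f)"
  unfolding continuous_on_sequentially
proof safe
  fix s :: "nat \<Rightarrow> real^'n" and a
  assume s: "s \<longlonglongrightarrow> a"
  note borel_measurable_schwartz[OF f, measurable]
  obtain C where C: "\<And>x t. norm (f (x - (x \<bullet> v) *\<^sub>R v + t *\<^sub>R v)) \<le> C * inverse (1 + t\<^sup>2)"
    by (rule schwartz_line_bound) blast
  \<comment> \<open>Projected base points share the dominating function of
    \<open>schwartz_line_bound\<close>; \<open>xray_perp\<close> removes the projections
    afterwards.\<close>
  have "(\<lambda>n. xray v f (s n - (s n \<bullet> v) *\<^sub>R v)) \<longlonglongrightarrow> xray v f (a - (a \<bullet> v) *\<^sub>R v)"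
    unfolding xray_def
  proof (rule integral_dominated_convergence)
    show "integrable lborel (\<lambda>t. C * inverse (1 + t\<^sup>2))"
      by (intro integrable_mult_right integrable_inverse_one_plus_square)
    show "AE t in lborel. (\<lambda>n. f (s n - (s n \<bullet> v) *\<^sub>R v + t *\<^sub>R v)) \<longlonglongrightarrow> f (a - (a \<bullet> v) *\<^sub>R v + t *\<^sub>R v)"
      by (intro AE_I2 continuous_on_tendsto_compose[OF continuous_on_schwartz[OF f, of UNIV]] tendsto_intros s) auto
  qed (use C in auto)
  then show "(xray v f \<circ> s) \<longlonglongrightarrow> xray v f a"
    unfolding comp_def xray_perp[symmetric] .
qed

text \<open>Split \<open>k\<close> into its components along and orthogonal to \<open>v\<close>. The
  orthogonal phase is constant on lines in direction \<open>v\<close> and can be moved inside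
  \<open>xray\<close>, while the other phase is absorbed into \<open>G\<close>; then
  \<open>integral_xray\<close> applies.\<close>

lemma fourier_transform_xray:
  assumes G: "integrable lborel G"
  shows "fourier_transform (\<lambda>x. G (x \<bullet> v) * xray v f x) k =
    (\<integral>u. exp (- \<i> * of_real ((k \<bullet> v) * u)) * G u \<partial>lborel) * fourier_transform f (k - (k \<bullet> v) *\<^sub>R v)"
proof -
  let ?k = "k - (k \<bullet> v) *\<^sub>R v"
  have "v \<bullet> v = 1" using v by (simp add: dot_square_norm)
  then have perp: "?k \<bullet> v = 0" by (simp add: inner_diff_left)
  have "exp (- \<i> * of_real (k \<bullet> x)) * (G (x \<bullet> v) * xray v f x) =
      (exp (- \<i> * of_real ((k \<bullet> v) * (x \<bullet> v))) * G (x \<bullet> v)) * xray v (\<lambda>y. exp (- \<i> * of_real (?k \<bullet> y)) * f y) x" for x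
  proof -
    have "xray v (\<lambda>y. exp (- \<i> * of_real (?k \<bullet> y)) * f y) x = exp (- \<i> * of_real (?k \<bullet> x)) * xray v f x"
      unfolding xray_def inner_add_right inner_scaleR_right perp by simp
    moreover have "exp (- \<i> * of_real (k \<bullet> x)) = exp (- \<i> * of_real ((k \<bullet> v) * (x \<bullet> v))) * exp (- \<i> * of_real (?k \<bullet> x))"
      unfolding exp_add[symmetric] by (simp add: inner_diff_left inner_commute algebra_simps)
    ultimately show ?thesis by (simp add: mult_ac)
  qed
  then show ?thesis
    unfolding fourier_transform_def
    using integral_xray[OF v integrable_modulate[OF integrable_schwartz[OF f], of ?k]
        integrable_modulate[OF G, of "k \<bullet> v"]]
    unfolding inner_real_def by (simp only:)
qed

text \<open>The Gaussian is used twice: its nonzero integral recovers the transform of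
  \<open>f\<close> on the hyperplane, and its lack of zeros recovers \<open>xray v f\<close> from
  the weighted function.\<close>

lemma xray_eq_0_iff:
  "(\<forall>x. xray v f x = 0) \<longleftrightarrow> (\<forall>k. k \<bullet> v = 0 \<longrightarrow> fourier_transform f k = 0)"
proof
  define G :: "real \<Rightarrow> complex" where "G u = of_real (exp (- (u\<^sup>2 / 2)))" for u
  have G: "integrable lborel G" "(\<integral>u. G u \<partial>lborel) \<noteq> 0"
    using integrable_gaussian_real[of 0] integral_gaussian_real[of 0] by (simp_all add: G_def[abs_def])
  have vv: "v \<bullet> v = 1" using v by (simp add: dot_square_norm)
  note slice = fourier_transform_xray[OF G(1)]
  show "\<forall>k. k \<bullet> v = 0 \<longrightarrow> fourier_transform f k = 0" if "\<forall>x. xray v f x = 0"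
  proof safe
    fix k assume k: "k \<bullet> v = 0"
    show "fourier_transform f k = 0"
      using slice[of k] that G(2) by (simp add: k) (simp add: fourier_transform_def)
  qed
  show "\<forall>x. xray v f x = 0" if F: "\<forall>k. k \<bullet> v = 0 \<longrightarrow> fourier_transform f k = 0"
  proof
    fix x
    have "G (x \<bullet> v) * xray v f x = 0"
    proof (rule fourier_transform_eq_0D)
      show "integrable lborel (\<lambda>x. G (x \<bullet> v) * xray v f x)"
        by (rule integrable_xray[OF v integrable_schwartz[OF f] G(1)])
      show "continuous_on UNIV (\<lambda>x. G (x \<bullet> v) * xray v f x)"
        unfolding G_def by (intro continuous_intros continuous_on_xray) auto
      obtain B where "\<And>x. norm (xray v f x) \<le> B"
        using bounded_xray by (auto simp: bounded_iff)
      moreover have "norm (G u) \<le> 1" for u by (simp add: G_def)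
      ultimately have "norm (G (x \<bullet> v) * xray v f x) \<le> 1 * B" for x
        unfolding norm_mult by (intro mult_mono) auto
      then show "bounded (range (\<lambda>x. G (x \<bullet> v) * xray v f x))"
        by (auto simp: bounded_iff)
      have "(k - (k \<bullet> v) *\<^sub>R v) \<bullet> v = 0" for k by (simp add: inner_diff_left vv)
      with F have "fourier_transform f (k - (k \<bullet> v) *\<^sub>R v) = 0" for k by blast
      then show "fourier_transform (\<lambda>x. G (x \<bullet> v) * xray v f x) k = 0" for k
        unfolding slice by simp
    qed
    then show "xray v f x = 0" by (simp add: G_def)
  qed
qed

end

section \<open>The Fourier transform of compactly supported smooth functions\<close>

text \<open>The difference quotient of the remainder is at most a constant times
  \<open>norm (y - x)\<close>. This criterion serves both for Fourier transforms and for bump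
  functions at and outside the sphere.\<close>

lemma has_derivative_quadratic_remainder:
  fixes f :: "'a::real_normed_vector \<Rightarrow> 'b::real_normed_vector"
  assumes L: "bounded_linear L" and le: "\<And>y. norm (f y - f x - L (y - x)) \<le> C * (norm (y - x))\<^sup>2"
  shows "(f has_derivative L) (at x)"
proof (rule has_derivativeI[OF L])
  have "((\<lambda>y. \<bar>C\<bar> * norm (y - x)) \<longlongrightarrow> \<bar>C\<bar> * norm (x - x)) (at x)"
    by (intro tendsto_intros)
  then have lim: "((\<lambda>y. \<bar>C\<bar> * norm (y - x)) \<longlongrightarrow> 0) (at x)" by simp
  show "((\<lambda>y. ((f y - f x) - L (y - x)) /\<^sub>R norm (y - x)) \<longlongrightarrow> 0) (at x)"
  proof (rule Lim_null_comparison[OF _ lim])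
    show "eventually (\<lambda>y. norm (((f y - f x) - L (y - x)) /\<^sub>R norm (y - x)) \<le> \<bar>C\<bar> * norm (y - x)) (at x)"
      unfolding eventually_at_filter
    proof (intro always_eventually allI impI)
      fix y assume "y \<noteq> x"
      have "norm (f y - f x - L (y - x)) \<le> \<bar>C\<bar> * (norm (y - x))\<^sup>2"
        by (rule order_trans[OF le]) (intro mult_right_mono, auto)
      with \<open>y \<noteq> x\<close> show "norm (((f y - f x) - L (y - x)) /\<^sub>R norm (y - x)) \<le> \<bar>C\<bar> * norm (y - x)"
        by (simp add: divide_simps power2_eq_square mult_ac)
    qed
  qed
qed

lemma partial_deriv_has_vector_derivative:
  assumes "f differentiable_on UNIV"
  shows "((\<lambda>t. f (x + t *\<^sub>R axis i 1)) has_vector_derivative partial_deriv i f (x + t *\<^sub>R axis i 1)) (at t)"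
proof -
  let ?x = "x + t *\<^sub>R axis i 1"
  obtain f' where f': "(f has_derivative f') (at ?x)"
    using assms by (force simp: differentiable_on_def differentiable_def)
  have "((\<lambda>t. f (x + t *\<^sub>R axis i 1)) has_derivative (\<lambda>t. f' (t *\<^sub>R axis i 1))) (at t)"
    by (rule has_derivative_compose[where g=f, of "\<lambda>t. x + t *\<^sub>R axis i 1"])
      (use f' in \<open>auto intro!: derivative_eq_intros\<close>)
  then show ?thesis
    unfolding has_vector_derivative_def partial_deriv_eq[OF f']
    by (simp add: linear_cmul[OF has_derivative_linear[OF f']])
qed

text \<open>On each line in direction \<open>axis i 1\<close> the fundamental theorem of calculus
  gives integral 0, since \<open>f\<close> vanishes far out. Then \<open>integral_xray\<close> with
  a Gaussian weight passes from lines to the whole space.\<close>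

lemma integral_partial_deriv:
  fixes f :: "real^'n \<Rightarrow> complex"
  assumes f: "f differentiable_on UNIV" and cont: "continuous_on UNIV (partial_deriv i f)"
    and int: "integrable lborel (partial_deriv i f)"
    and supp: "\<And>x. norm x > R \<Longrightarrow> f x = 0" "\<And>x. norm x > R \<Longrightarrow> partial_deriv i f x = 0"
  shows "(\<integral>x. partial_deriv i f x \<partial>lborel) = 0"
proof -
  let ?v = "axis i 1 :: real^'n"
  have "xray ?v (partial_deriv i f) x = 0" for x
  proof -
    \<comment> \<open>Beyond this parameter the reverse triangle inequality puts the point outside
      the ball of radius \<open>R\<close>.\<close>
    let ?T = "\<bar>R\<bar> + norm x + 1"
    have far: "norm (x + t *\<^sub>R ?v) > R" if "\<bar>t\<bar> \<ge> ?T" for t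
      using that norm_triangle_ineq2[of "t *\<^sub>R ?v" "- x"] by (simp add: add.commute)
    have "has_bochner_integral lborel (\<lambda>t. indicator {- ?T..?T} t *\<^sub>R partial_deriv i f (x + t *\<^sub>R ?v))
        (f (x + ?T *\<^sub>R ?v) - f (x + (- ?T) *\<^sub>R ?v))"
    proof (rule has_bochner_integral_FTC_Icc)
      show "((\<lambda>t. f (x + t *\<^sub>R ?v)) has_vector_derivative partial_deriv i f (x + t *\<^sub>R ?v))
          (at t within {- ?T..?T})" for t
        by (rule has_vector_derivative_at_within[OF partial_deriv_has_vector_derivative[OF f]])
      show "continuous_on {- ?T..?T} (\<lambda>t. partial_deriv i f (x + t *\<^sub>R ?v))"
        by (rule continuous_on_compose2[OF cont]) (auto intro!: continuous_intros)
    qed auto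
    moreover have "indicator {- ?T..?T} t *\<^sub>R partial_deriv i f (x + t *\<^sub>R ?v) = partial_deriv i f (x + t *\<^sub>R ?v)" for t
      using supp(2)[OF far[of t]] by (auto simp: indicator_def)
    moreover have "f (x + ?T *\<^sub>R ?v) = 0" "f (x + (- ?T) *\<^sub>R ?v) = 0"
      by (intro supp(1) far; simp)+
    ultimately show ?thesis
      unfolding xray_def by (simp only: has_bochner_integral_iff) simp
  qed
  then show ?thesis
    using integral_xray[OF _ int integrable_gaussian_real[of 0], of ?v] integral_gaussian_real[of 0] by simp
qed

lemma norm_fourier_transform_le: "norm (fourier_transform f x) \<le> (\<integral>y. norm (f y) \<partial>lborel)"
  unfolding fourier_transform_def
  by (rule order_trans[OF integral_norm_bound]) (simp add: norm_mult)

lemma norm_exp_minus_i_remainder: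
  "norm (exp (- \<i> * of_real t) - 1 + \<i> * of_real t) \<le> t\<^sup>2"
proof -
  have "norm (iexp (- t) - (\<Sum>k\<le>1. (\<i> * of_real (- t)) ^ k / fact k)) \<le> \<bar>- t\<bar> ^ Suc 1 / fact (Suc 1)"
    by (rule iexp_approx1)
  also have "\<dots> \<le> t\<^sup>2"
    by (simp add: numeral_2_eq_2)
  finally show ?thesis
    by (simp add: algebra_simps)
qed

text \<open>Only closure under the two operations that the Fourier transform exchanges,
  differentiation and multiplication by coordinates, is recorded, together with a common bounded
  support. This suffices to prove that the transforms are Schwartz functions.\<close>

locale test_functions =
  fixes \<D> :: "(real^'n \<Rightarrow> complex) set" and R :: real
  assumes test_differentiable: "f \<in> \<D> \<Longrightarrow> f differentiable_on UNIV"
    and test_partial_deriv: "f \<in> \<D> \<Longrightarrow> partial_deriv i f \<in> \<D>"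
    and test_mult: "f \<in> \<D> \<Longrightarrow> (\<lambda>x. of_real (x $ i) * f x) \<in> \<D>"
    and test_support: "f \<in> \<D> \<Longrightarrow> norm x > R \<Longrightarrow> f x = 0"
begin

lemma test_continuous: "f \<in> \<D> \<Longrightarrow> continuous_on UNIV f"
  by (intro differentiable_imp_continuous_on test_differentiable)

lemma integrable_test:
  assumes f: "f \<in> \<D>" shows "integrable lborel f"
proof -
  have "f = (\<lambda>x. indicator (cball 0 R) x *\<^sub>R f x)"
    using test_support[OF f] by (force simp: indicator_def fun_eq_iff)
  moreover have "integrable lborel (\<lambda>x. indicator (cball 0 R) x *\<^sub>R f x)"
    by (intro borel_integrable_compact continuous_on_subset[OF test_continuous[OF f]]) auto
  ultimately show ?thesis by simp
qed

text \<open>Differentiation under the integral: the remainder of the phase is quadratic in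
  \<open>(y - x) \<bullet> k\<close>, and \<open>norm k\<close> is at most \<open>R\<close> where
  \<open>f\<close> is nonzero.\<close>

lemma has_derivative_fourier_transform:
  assumes f: "f \<in> \<D>"
  shows "(fourier_transform f has_derivative
    (\<lambda>h. \<Sum>i\<in>UNIV. (h $ i) *\<^sub>R (- \<i> * fourier_transform (\<lambda>k. of_real (k $ i) * f k) x))) (at x)"
    (is "(_ has_derivative ?L) _")
proof (rule has_derivative_quadratic_remainder)
  show "bounded_linear ?L"
    by (intro bounded_linear_sum bounded_linear_scaleR_const bounded_linear_vec_nth)
  let ?I = "\<lambda>y k. exp (- \<i> * of_real (y \<bullet> k)) * f k"
  let ?J = "\<lambda>h k. exp (- \<i> * of_real (x \<bullet> k)) * (- \<i> * of_real (h \<bullet> k) * f k)"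
  have J: "?J h = (\<lambda>k. \<Sum>i\<in>UNIV. (h $ i) *\<^sub>R (- \<i> * (exp (- \<i> * of_real (x \<bullet> k)) * (of_real (k $ i) * f k))))" for h
    by (simp add: fun_eq_iff inner_vec_def[of h] sum_distrib_left sum_distrib_right scaleR_conv_of_real mult_ac)
  have int: "integrable lborel (?I y)" for y
    by (intro integrable_modulate integrable_test f)
  have int_i: "integrable lborel (\<lambda>k. exp (- \<i> * of_real (x \<bullet> k)) * (of_real (k $ i) * f k))" for i
    by (intro integrable_modulate integrable_test test_mult f)
  have int_J: "integrable lborel (?J h)" for h
    unfolding J by (intro Bochner_Integration.integrable_sum integrable_scaleR_right integrable_mult_right int_i)
  have L: "?L h = (\<integral>k. ?J h k \<partial>lborel)" for h
    unfolding J using int_i by (simp add: fourier_transform_def)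
  fix y
  have "fourier_transform f y - fourier_transform f x - ?L (y - x) = (\<integral>k. ?I y k - ?I x k - ?J (y - x) k \<partial>lborel)"
    unfolding L unfolding fourier_transform_def
    by (simp only: Bochner_Integration.integral_diff Bochner_Integration.integrable_diff int int_J)
  also have "norm \<dots> \<le> (\<integral>k. (norm (y - x))\<^sup>2 * R\<^sup>2 * norm (f k) \<partial>lborel)"
  proof (rule Bochner_Integration.integral_norm_bound_integral)
    show "norm (?I y k - ?I x k - ?J (y - x) k) \<le> (norm (y - x))\<^sup>2 * R\<^sup>2 * norm (f k)" for k
    proof (cases "norm k > R")
      case False
      let ?t = "(y - x) \<bullet> k"
      have "exp (- \<i> * of_real (y \<bullet> k)) = exp (- \<i> * of_real (x \<bullet> k)) * exp (- \<i> * of_real ?t)"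
        unfolding exp_add[symmetric] by (simp add: inner_diff_left algebra_simps)
      \<comment> \<open>Factoring out the phase at \<open>x\<close> leaves the first-order Taylor
        remainder of the exponential.\<close>
      then have "?I y k - ?I x k - ?J (y - x) k =
          exp (- \<i> * of_real (x \<bullet> k)) * (exp (- \<i> * of_real ?t) - 1 + \<i> * of_real ?t) * f k"
        by (simp add: algebra_simps)
      then have "norm (?I y k - ?I x k - ?J (y - x) k) = norm (exp (- \<i> * of_real ?t) - 1 + \<i> * of_real ?t) * norm (f k)"
        by (simp only: norm_mult norm_exp_minus_i mult_1_left)
      also have "\<dots> \<le> ?t\<^sup>2 * norm (f k)"
        by (intro mult_right_mono norm_exp_minus_i_remainder) auto
      also have "\<dots> \<le> (norm (y - x) * norm k)\<^sup>2 * norm (f k)"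
        by (intro mult_right_mono) (auto simp: abs_le_square_iff[symmetric] abs_mult Cauchy_Schwarz_ineq2)
      also have "\<dots> \<le> (norm (y - x) * R)\<^sup>2 * norm (f k)"
        using False by (intro mult_right_mono power_mono mult_left_mono) auto
      finally show ?thesis by (simp add: power_mult_distrib)
    qed (simp add: test_support[OF f])
  qed (use int int_J integrable_test[OF f] in auto)
  also have "\<dots> = (R\<^sup>2 * (\<integral>k. norm (f k) \<partial>lborel)) * (norm (y - x))\<^sup>2"
    by simp
  finally show "norm (fourier_transform f y - fourier_transform f x - ?L (y - x))
      \<le> (R\<^sup>2 * (\<integral>k. norm (f k) \<partial>lborel)) * (norm (y - x))\<^sup>2" .
qed

text \<open>The class \<open>\<D>\<close> is not assumed closed under scalars, so constants are
  collected in \<open>z\<close> to let the formula be iterated.\<close>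

lemma partial_deriv_fourier_transform:
  assumes f: "f \<in> \<D>"
  shows "partial_deriv i (\<lambda>x. z * fourier_transform f x) = (\<lambda>x. (- \<i> * z) * fourier_transform (\<lambda>k. of_real (k $ i) * f k) x)"
proof
  fix x
  have "(\<Sum>j\<in>UNIV. (axis i 1 $ j) *\<^sub>R (- \<i> * fourier_transform (\<lambda>k. of_real (k $ j) * f k) x)) =
      (\<Sum>j\<in>UNIV. if j = i then - \<i> * fourier_transform (\<lambda>k. of_real (k $ j) * f k) x else 0)"
    by (intro sum.cong) (auto simp: axis_def)
  then show "partial_deriv i (\<lambda>x. z * fourier_transform f x) x = (- \<i> * z) * fourier_transform (\<lambda>k. of_real (k $ i) * f k) x"
    unfolding partial_deriv_eq[OF has_derivative_mult_right[OF has_derivative_fourier_transform[OF f]]]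
    by (simp add: mult_ac)
qed

lemma iter_partial_fourier_transform:
  assumes f: "f \<in> \<D>"
  shows "\<exists>z. \<exists>g\<in>\<D>. iter_partial is (fourier_transform f) = (\<lambda>x. z * fourier_transform g x)"
proof (induction "is")
  case Nil
  have "iter_partial [] (fourier_transform f) = (\<lambda>x. 1 * fourier_transform f x)" by simp
  with f show ?case by blast
next
  case (Cons i "is")
  then obtain z g where "g \<in> \<D>" "iter_partial is (fourier_transform f) = (\<lambda>x. z * fourier_transform g x)"
    by blast
  then have "iter_partial (i # is) (fourier_transform f) = (\<lambda>x. (- \<i> * z) * fourier_transform (\<lambda>k. of_real (k $ i) * g k) x)"
    by (simp only: iter_partial.simps partial_deriv_fourier_transform)
  with test_mult[OF \<open>g \<in> \<D>\<close>] show ?case by blast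
qed

text \<open>Integration by parts: the product \<open>?h\<close> of phase and \<open>f\<close> is
  differentiated by the product rule, and \<open>integral_partial_deriv\<close> makes the total
  integral vanish.\<close>

lemma fourier_transform_partial_deriv:
  assumes f: "f \<in> \<D>"
  shows "of_real (x $ i) * fourier_transform f x = - \<i> * fourier_transform (partial_deriv i f) x"
proof -
  let ?e = "\<lambda>k. exp (- \<i> * of_real (x \<bullet> k))"
  let ?h = "\<lambda>k. ?e k * f k"
  have f_diff: "f differentiable at k" for k
    using test_differentiable[OF f] by (simp add: differentiable_on_def)
  have e: "(?e has_derivative (\<lambda>h. ?e k * (- \<i> * of_real (x \<bullet> h)))) (at k)" for k
  proof -
    have "((\<lambda>k. - \<i> * of_real (x \<bullet> k)) has_derivative (\<lambda>h. - \<i> * of_real (x \<bullet> h))) (at k)"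
      by (intro has_derivative_mult_right has_derivative_of_real has_derivative_inner_right has_derivative_ident)
    from has_derivative_compose[OF this DERIV_exp[unfolded has_field_derivative_def]] show ?thesis .
  qed
  have pd: "partial_deriv i ?h = (\<lambda>k. ?e k * partial_deriv i f k - \<i> * of_real (x $ i) * (?e k * f k))"
  proof
    fix k
    obtain f' where f': "(f has_derivative f') (at k)"
      using f_diff by (auto simp: differentiable_def)
    show "partial_deriv i ?h k = ?e k * partial_deriv i f k - \<i> * of_real (x $ i) * (?e k * f k)"
      unfolding partial_deriv_eq[OF has_derivative_mult[OF e f']] partial_deriv_eq[OF f']
      by (simp add: inner_axis algebra_simps)
  qed
  have int: "integrable lborel (\<lambda>k. ?e k * partial_deriv i f k)" "integrable lborel (\<lambda>k. ?e k * f k)"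
    by (intro integrable_modulate integrable_test test_partial_deriv f)+
  have "(\<integral>k. partial_deriv i ?h k \<partial>lborel) = 0"
  proof (rule integral_partial_deriv)
    show "?h differentiable_on UNIV"
      unfolding differentiable_on_def
      by (intro ballI differentiable_mult f_diff) (use e in \<open>auto simp: differentiable_def\<close>)
    show "continuous_on UNIV (partial_deriv i ?h)"
      unfolding pd by (intro continuous_intros test_continuous test_partial_deriv f)
    show "integrable lborel (partial_deriv i ?h)"
      unfolding pd by (intro Bochner_Integration.integrable_diff integrable_mult_right int)
    show "?h k = 0" "partial_deriv i ?h k = 0" if "norm k > R" for k
      unfolding pd using that test_support[OF f] test_support[OF test_partial_deriv[OF f]] by simp_all
  qed
  then have "fourier_transform (partial_deriv i f) x = \<i> * of_real (x $ i) * fourier_transform f x"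
    unfolding pd using int by (simp add: fourier_transform_def)
  then show ?thesis by (simp add: mult.assoc[symmetric])
qed

text \<open>Each coordinate factor is traded for a partial derivative of the test function and a
  scalar \<open>- \<i>\<close>; the outer induction runs over coordinates, the inner one over the
  exponent.\<close>

lemma monomial_mult_fourier_transform:
  assumes f: "f \<in> \<D>" and S: "finite S"
  shows "\<exists>z. \<exists>g\<in>\<D>. \<forall>x. (\<Prod>i\<in>S. of_real (x $ i) ^ \<alpha> i) * fourier_transform f x = z * fourier_transform g x"
  using S
proof induction
  case empty
  have "\<forall>x. (\<Prod>i\<in>{}. of_real (x $ i) ^ \<alpha> i) * fourier_transform f x = 1 * fourier_transform f x" by simp
  with f show ?case by blast
next
  case (insert i S)
  then obtain z g where g: "g \<in> \<D>"
    "\<And>x. (\<Prod>i\<in>S. of_real (x $ i) ^ \<alpha> i) * fourier_transform f x = z * fourier_transform g x"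
    by blast
  have "\<exists>z. \<exists>g\<in>\<D>. \<forall>x. of_real (x $ i) ^ m * ((\<Prod>i\<in>S. of_real (x $ i) ^ \<alpha> i) * fourier_transform f x) = z * fourier_transform g x" for m
  proof (induction m)
    case (Suc m)
    then obtain z g where g: "g \<in> \<D>"
      "\<And>x. of_real (x $ i) ^ m * ((\<Prod>i\<in>S. of_real (x $ i) ^ \<alpha> i) * fourier_transform f x) = z * fourier_transform g x"
      by blast
    have "of_real (x $ i) ^ Suc m * ((\<Prod>i\<in>S. of_real (x $ i) ^ \<alpha> i) * fourier_transform f x) =
       (- \<i> * z) * fourier_transform (partial_deriv i g) x" for x
    proof -
      have "of_real (x $ i) ^ Suc m * ((\<Prod>i\<in>S. of_real (x $ i) ^ \<alpha> i) * fourier_transform f x) =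
          z * (of_real (x $ i) * fourier_transform g x)"
        using g(2)[of x] by (simp add: mult_ac)
      then show ?thesis
        unfolding fourier_transform_partial_deriv[OF g(1)] by (simp add: mult_ac)
    qed
    with test_partial_deriv[OF g(1)] show ?case by blast
  qed (use g in auto)
  from this[of "\<alpha> i"] show ?case
    using insert.hyps by (simp add: mult.assoc)
qed

text \<open>Iterated derivatives and monomial factors only replace the test function and a scalar,
  and every transform is bounded by the integral of the norm.\<close>

theorem fourier_transform_in_schwartz_space:
  assumes f: "f \<in> \<D>"
  shows "fourier_transform f \<in> schwartz_space"
proof -
  have "smooth_fun (fourier_transform f)"
    unfolding smooth_fun_def
  proof
    fix "is"
    obtain z g where g: "g \<in> \<D>" "iter_partial is (fourier_transform f) = (\<lambda>x. z * fourier_transform g x)"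
      using iter_partial_fourier_transform[OF f] by blast
    show "iter_partial is (fourier_transform f) differentiable_on UNIV"
      unfolding differentiable_on_def differentiable_def g(2)
      using has_derivative_mult_right[OF has_derivative_fourier_transform[OF g(1)]] by blast
  qed
  moreover have "bounded (range (\<lambda>x. (\<Prod>i\<in>UNIV. (x $ i) ^ \<alpha> i) *\<^sub>R iter_partial is (fourier_transform f) x))" for \<alpha> "is"
  proof -
    obtain z g where g: "g \<in> \<D>" "iter_partial is (fourier_transform f) = (\<lambda>x. z * fourier_transform g x)"
      using iter_partial_fourier_transform[OF f] by blast
    obtain w h where h: "h \<in> \<D>"
      "\<And>x. (\<Prod>i\<in>UNIV. of_real (x $ i) ^ \<alpha> i) * fourier_transform g x = w * fourier_transform h x"
      using monomial_mult_fourier_transform[OF g(1) finite, of \<alpha> UNIV] by blast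
    have "(\<Prod>i\<in>UNIV. (x $ i) ^ \<alpha> i) *\<^sub>R iter_partial is (fourier_transform f) x = z * (w * fourier_transform h x)" for x
      unfolding g(2) h(2)[symmetric] by (simp add: scaleR_conv_of_real)
    moreover have "norm (z * (w * fourier_transform h x)) \<le> norm z * (norm w * (\<integral>y. norm (h y) \<partial>lborel))" for x
      unfolding norm_mult by (intro mult_left_mono norm_fourier_transform_le) auto
    ultimately show ?thesis
      by (auto simp: bounded_iff)
  qed
  ultimately show ?thesis
    by (simp add: schwartz_space_def)
qed

end

section \<open>Bump functions\<close>

text \<open>For a fixed direction the derivative is again polynomial in the point, which keeps the
  polynomial factor of a bump polynomial under differentiation.\<close>

lemma real_polynomial_function_has_derivative:
  assumes "real_polynomial_function p"
  shows "\<exists>p'. (\<forall>x. (p has_derivative p' x) (at x)) \<and> (\<forall>h. real_polynomial_function (\<lambda>x. p' x h))"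
  using assms
proof induction
  case (linear f)
  then show ?case
    by (intro exI[of _ "\<lambda>_. f"]) (auto intro: bounded_linear_imp_has_derivative)
next
  case (const c)
  show ?case by (intro exI[of _ "\<lambda>_ _. 0"]) auto
next
  case (add f g)
  then obtain f' g' where
    "\<And>x. (f has_derivative f' x) (at x)" "\<And>h. real_polynomial_function (\<lambda>x. f' x h)"
    "\<And>x. (g has_derivative g' x) (at x)" "\<And>h. real_polynomial_function (\<lambda>x. g' x h)"
    by blast
  then show ?case
    by (intro exI[of _ "\<lambda>x h. f' x h + g' x h"]) (auto intro: has_derivative_add)
next
  case (mult f g)
  then obtain f' g' where
    "\<And>x. (f has_derivative f' x) (at x)" "\<And>h. real_polynomial_function (\<lambda>x. f' x h)"
    "\<And>x. (g has_derivative g' x) (at x)" "\<And>h. real_polynomial_function (\<lambda>x. g' x h)"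
    by blast
  with mult.hyps show ?case
    by (intro exI[of _ "\<lambda>x h. f x * g' x h + f' x h * g x"])
      (auto intro!: has_derivative_mult real_polynomial_function.intros(3,4))
qed

text \<open>Squaring makes this measure of depth inside the ball a polynomial.\<close>

definition ball_gap :: "'a::real_inner \<Rightarrow> real \<Rightarrow> 'a \<Rightarrow> real" where
  "ball_gap c r x = r\<^sup>2 - (norm (x - c))\<^sup>2"

text \<open>The polynomial factor \<open>p\<close> and the power \<open>n\<close> make this class closed under partial derivatives.\<close>

definition bump :: "'a::real_inner \<Rightarrow> real \<Rightarrow> ('a \<Rightarrow> real) \<Rightarrow> nat \<Rightarrow> 'a \<Rightarrow> real" where
  "bump c r p n x =
    (if ball_gap c r x > 0 then p x * (exp (- 1 / ball_gap c r x) / ball_gap c r x ^ n) else 0)"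

text \<open>From \<open>exp (1 / s) \<ge> (1 + 1 / ((n + 2) * s)) ^ (n + 2)\<close>; the exponent
  \<open>n + 2\<close> leaves a factor \<open>s\<^sup>2\<close> after division by
  \<open>s ^ n\<close>, as \<open>has_derivative_quadratic_remainder\<close> will require.\<close>

lemma exp_minus_inverse_le:
  fixes s :: real
  assumes "s > 0"
  shows "exp (- 1 / s) / s ^ n \<le> real (n + 2) ^ (n + 2) * s\<^sup>2"
proof -
  have "(1 / (real (n + 2) * s)) ^ (n + 2) \<le> (1 + (1 / s) / real (n + 2)) ^ (n + 2)"
    using assms by (intro power_mono) (auto simp: field_simps)
  also have "\<dots> \<le> exp (1 / s)"
    using assms by (intro exp_ge_one_plus_x_over_n_power_n) (auto intro: order_trans[of _ 0])
  finally have "1 / exp (1 / s) \<le> real (n + 2) ^ (n + 2) * s ^ (n + 2)"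
    using assms by (simp only: power_divide power_mult_distrib power_one) (simp add: field_simps del: power_Suc add_2_eq_Suc')
  then have "1 / exp (1 / s) / s ^ n \<le> real (n + 2) ^ (n + 2) * s ^ (n + 2) / s ^ n"
    using assms by (intro divide_right_mono) auto
  then show ?thesis
    using assms by (simp add: exp_minus power_add inverse_eq_divide power2_eq_square mult_ac)
qed

lemma DERIV_exp_minus_inverse_div_power:
  fixes s :: real
  assumes "s > 0"
  shows "((\<lambda>s. exp (- 1 / s) / s ^ n) has_field_derivative exp (- 1 / s) * (1 - real n * s) / s ^ (n + 2)) (at s)"
proof -
  \<comment> \<open>The derivative of \<open>s ^ n\<close> contains \<open>s ^ (n - 1)\<close> with
    truncated subtraction, so \<open>n = 0\<close> is separated.\<close>
  have "n = 0 \<or> s ^ n = s * s ^ (n - 1)"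
    by (cases n) auto
  then show ?thesis
    using assms by (auto intro!: derivative_eq_intros simp: field_simps power2_eq_square)
qed

lemma real_polynomial_function_ball_gap: "real_polynomial_function (ball_gap c r :: real^'n \<Rightarrow> real)"
proof -
  have "ball_gap c r = (\<lambda>x. r\<^sup>2 - (\<Sum>i\<in>UNIV. (x $ i - c $ i)\<^sup>2))"
    unfolding ball_gap_def fun_eq_iff power2_norm_eq_inner inner_vec_def by (simp add: power2_eq_square)
  then show ?thesis
    by (auto intro!: real_polynomial_function_diff real_polynomial_function_sum real_polynomial_function_power
        bounded_linear_vec_nth)
qed

lemma ball_gap_has_derivative: "(ball_gap c r has_derivative (\<lambda>h. - 2 * ((x - c) \<bullet> h))) (at x)"
  unfolding ball_gap_def[abs_def] power2_norm_eq_inner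
  by (auto intro!: derivative_eq_intros simp: inner_commute)

context
  fixes c :: "real^'n" and r :: real
  assumes r: "r > 0"
begin

abbreviation q :: "real^'n \<Rightarrow> real" where "q \<equiv> ball_gap c r"

lemma ball_gap_pos_iff: "q x > 0 \<longleftrightarrow> norm (x - c) < r"
  using r abs_le_square_iff[of r "norm (x - c)"] by (simp add: ball_gap_def not_le[symmetric])

text \<open>Inside the ball the bump is at most a constant times \<open>(q y)\<^sup>2\<close>, and
  \<open>q y\<close> factors as \<open>(r - norm (y - c)) * (r + norm (y - c))\<close>, which is at
  most \<open>2 * r * norm (y - x)\<close> because \<open>x\<close> lies on or outside the
  sphere.\<close>

lemma bump_quadratic_bound:
  assumes p: "real_polynomial_function p" and x: "q x \<le> 0"
  obtains C where "\<And>y. \<bar>bump c r p n y\<bar> \<le> C * (norm (y - x))\<^sup>2"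
proof -
  have "continuous_on (cball c r) p"
    using p by (intro continuous_on_polymonial_function) (simp add: real_polynomial_function_eq)
  then have "bounded (p ` cball c r)"
    by (intro compact_imp_bounded compact_continuous_image) auto
  then have "\<exists>M>0. \<forall>y\<in>cball c r. \<bar>p y\<bar> \<le> M"
    by (simp add: bounded_pos)
  then obtain M where M: "\<And>y. y \<in> cball c r \<Longrightarrow> \<bar>p y\<bar> \<le> M" and "M > 0"
    by blast
  let ?K = "real (n + 2) ^ (n + 2)"
  show thesis
  proof
    fix y
    show "\<bar>bump c r p n y\<bar> \<le> (M * ?K * (2 * r)\<^sup>2) * (norm (y - x))\<^sup>2"
    proof (cases "q y > 0")
      case True
      then have y: "norm (y - c) < r" by (simp add: ball_gap_pos_iff)
      have "r \<le> norm (x - c)" using x ball_gap_pos_iff[of x] by linarith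
      also have "\<dots> \<le> norm (y - c) + norm (y - x)"
        by (metis norm_minus_commute norm_triangle_sub add.commute diff_add_cancel norm_triangle_ineq diff_diff_eq2)
      finally have "r - norm (y - c) \<le> norm (y - x)" by simp
      then have "(r - norm (y - c)) * (r + norm (y - c)) \<le> norm (y - x) * (2 * r)"
        using y r by (intro mult_mono) auto
      moreover have "q y = (r - norm (y - c)) * (r + norm (y - c))"
        by (simp add: ball_gap_def power2_eq_square algebra_simps)
      ultimately have qy: "q y \<le> 2 * r * norm (y - x)" by (simp add: mult_ac)
      have "\<bar>bump c r p n y\<bar> = \<bar>p y\<bar> * (exp (- 1 / q y) / q y ^ n)"
        using True by (simp add: bump_def abs_mult)
      also have "\<dots> \<le> M * (?K * (q y)\<^sup>2)"
        using True y \<open>M > 0\<close>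
        by (intro mult_mono exp_minus_inverse_le M) (auto simp: dist_norm norm_minus_commute)
      also have "\<dots> \<le> M * (?K * (2 * r * norm (y - x))\<^sup>2)"
        using True qy \<open>M > 0\<close> by (intro mult_left_mono power_mono) auto
      finally show ?thesis by (simp add: power_mult_distrib mult_ac)
    qed (use \<open>M > 0\<close> in \<open>simp add: bump_def\<close>)
  qed
qed

text \<open>Inside the ball this is the product rule over the common denominator
  \<open>q x ^ (n + 2)\<close>. Elsewhere the quadratic bound gives derivative 0, which is also the
  value of the right-hand bump, so one formula covers both cases.\<close>

lemma bump_has_derivative:
  assumes p: "real_polynomial_function p" and p': "\<And>x. (p has_derivative p' x) (at x)"
  shows "(bump c r p n has_derivative (\<lambda>h. bump c r
    (\<lambda>x. p' x h * (q x)\<^sup>2 + p x * (- 2 * ((x - c) \<bullet> h)) - real n * p x * (- 2 * ((x - c) \<bullet> h)) * q x) (n + 2) x)) (at x)"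
    (is "(_ has_derivative ?B) _")
proof (cases "q x > 0")
  case True
  let ?D = "\<lambda>h. - 2 * ((x - c) \<bullet> h)" and ?E = "exp (- 1 / q x)"
  have "((\<lambda>y. exp (- 1 / q y) / q y ^ n) has_derivative (\<lambda>h. ?E * (1 - real n * q x) / q x ^ (n + 2) * ?D h)) (at x)"
    using has_derivative_compose[OF ball_gap_has_derivative, of "\<lambda>s. exp (- 1 / s) / s ^ n"]
      DERIV_exp_minus_inverse_div_power[OF True] unfolding has_field_derivative_def by blast
  from has_derivative_mult[OF p' this]
  have "((\<lambda>y. p y * (exp (- 1 / q y) / q y ^ n)) has_derivative ?B) (at x)"
  proof (rule has_derivative_eq_rhs)
    show "(\<lambda>h. p x * (?E * (1 - real n * q x) / q x ^ (n + 2) * ?D h) + p' x h * (?E / q x ^ n)) = ?B"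
    proof
      fix h
      have "p x * (E * (1 - real n * Q) / Q ^ (n + 2) * d) + p' x h * (E / Q ^ n) =
         (p' x h * Q\<^sup>2 + p x * d - real n * p x * d * Q) * (E / Q ^ (n + 2))" if "Q > 0" for Q d E
        using that by (simp add: field_simps power2_eq_square)
      from this[OF True, of ?E "?D h"]
      show "p x * (?E * (1 - real n * q x) / q x ^ (n + 2) * ?D h) + p' x h * (?E / q x ^ n) = ?B h"
        unfolding bump_def if_P[OF True] .
    qed
  qed
  moreover have "open {y. q y > 0}"
    unfolding ball_gap_def by (intro open_Collect_less continuous_intros)
  ultimately show ?thesis
    by (rule has_derivative_transform_within_open) (auto simp: bump_def True)
next
  case False
  then obtain C where C: "\<And>y. \<bar>bump c r p n y\<bar> \<le> C * (norm (y - x))\<^sup>2"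
    using bump_quadratic_bound[OF p, of x n] by force
  have "(bump c r p n has_derivative (\<lambda>h. 0)) (at x)"
    by (rule has_derivative_quadratic_remainder[where C=C]) (use C False in \<open>auto simp: bump_def\<close>)
  then show ?thesis
    using False by (simp add: bump_def)
qed

lemma test_functions_bump:
  "test_functions {\<lambda>x. of_real (bump c r p n x) | p n. real_polynomial_function p} (norm c + r)"
proof
  fix f :: "real^'n \<Rightarrow> complex" and i
  assume "f \<in> {\<lambda>x. of_real (bump c r p n x) | p n. real_polynomial_function p}"
  then obtain p n where f: "f = (\<lambda>x. of_real (bump c r p n x))" and p: "real_polynomial_function p"
    by blast
  obtain p' where p': "\<And>x. (p has_derivative p' x) (at x)" "\<And>h. real_polynomial_function (\<lambda>x. p' x h)"
    using real_polynomial_function_has_derivative[OF p] by blast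
  \<comment> \<open>The polynomial factor from \<open>bump_has_derivative\<close>, with the
    direction \<open>h\<close> as a parameter.\<close>
  let ?p = "\<lambda>h x. p' x h * (q x)\<^sup>2 + p x * (- 2 * ((x - c) \<bullet> h)) - real n * p x * (- 2 * ((x - c) \<bullet> h)) * q x"
  have D: "(f has_derivative (\<lambda>h. of_real (bump c r (?p h) (n + 2) x))) (at x)" for x
    unfolding f by (intro has_derivative_of_real bump_has_derivative p p')
  show "f differentiable_on UNIV"
    using D by (auto simp: differentiable_on_def differentiable_def)
  have lin: "real_polynomial_function (\<lambda>x. (x - c) \<bullet> h)" for h :: "real^'n"
    unfolding inner_diff_left
    by (intro real_polynomial_function_diff real_polynomial_function.intros bounded_linear_inner_left)
  have "real_polynomial_function (?p h)" for h
    by (intro real_polynomial_function_diff real_polynomial_function.intros real_polynomial_function_power p p' lin real_polynomial_function_ball_gap)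
  moreover have "partial_deriv i f = (\<lambda>x. of_real (bump c r (?p (axis i 1)) (n + 2) x))"
    using partial_deriv_eq[OF D] by blast
  ultimately show "partial_deriv i f \<in> {\<lambda>x. of_real (bump c r p n x) | p n. real_polynomial_function p}"
    by blast
  have "(\<lambda>x. of_real (x $ i) * f x) = (\<lambda>x. of_real (bump c r (\<lambda>x. x $ i * p x) n x))"
    by (auto simp: f bump_def fun_eq_iff)
  moreover have "real_polynomial_function (\<lambda>x. x $ i * p x)"
    by (intro real_polynomial_function.intros bounded_linear_vec_nth p)
  ultimately show "(\<lambda>x. of_real (x $ i) * f x) \<in> {\<lambda>x. of_real (bump c r p n x) | p n. real_polynomial_function p}"
    by blast
  fix x :: "real^'n" assume "norm x > norm c + r"
  then have "\<not> norm (x - c) < r" using norm_triangle_sub[of x c] by linarith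
  then show "f x = 0" by (simp add: f bump_def ball_gap_pos_iff)
qed

end

text \<open>The witness is the transform of a bump centred at \<open>- a\<close>; by inversion its
  own transform is a multiple of the reflected bump, nonzero exactly on
  \<open>ball a r\<close>.\<close>

lemma exists_schwartz_fourier_transform_support:
  fixes a :: "real^'n"
  assumes r: "r > 0"
  obtains f where "f \<in> schwartz_space" "fourier_transform f a \<noteq> 0"
    "\<And>k. k \<notin> ball a r \<Longrightarrow> fourier_transform f k = 0"
proof
  let ?B = "{\<lambda>x. of_real (bump (- a) r p n x) | p n. real_polynomial_function p} :: (real^'n \<Rightarrow> complex) set"
  interpret test_functions ?B "norm (- a) + r"
    by (rule test_functions_bump[OF r])
  define \<phi> :: "real^'n \<Rightarrow> complex" where "\<phi> = (\<lambda>x. of_real (bump (- a) r (\<lambda>_. 1) 0 x))"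
  have \<phi>: "\<phi> \<in> ?B" unfolding \<phi>_def by blast
  show F: "fourier_transform \<phi> \<in> schwartz_space"
    by (rule fourier_transform_in_schwartz_space[OF \<phi>])
  have "norm (\<phi> x) \<le> 1" for x
    by (simp add: \<phi>_def bump_def)
  then have "bounded (range \<phi>)" by (auto simp: bounded_iff)
  then have FF: "fourier_transform (fourier_transform \<phi>) k = of_real ((2 * pi) ^ CARD('n)) * \<phi> (- k)" for k
    by (intro fourier_transform_fourier_transform integrable_test[OF \<phi>] test_continuous[OF \<phi>] integrable_schwartz[OF F])
  have \<phi>_iff: "\<phi> (- k) = 0 \<longleftrightarrow> k \<notin> ball a r" for k
  proof -
    have "norm (- k - - a) = dist a k" by (simp add: dist_norm)
    then show ?thesis
      using ball_gap_pos_iff[OF r, of "- a" "- k"] by (simp add: \<phi>_def bump_def)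
  qed
  show "fourier_transform (fourier_transform \<phi>) a \<noteq> 0"
    unfolding FF using r \<phi>_iff[of a] by simp
  show "fourier_transform (fourier_transform \<phi>) k = 0" if "k \<notin> ball a r" for k
    unfolding FF using that \<phi>_iff[of k] by simp
qed

section \<open>The equivalence and the injectivity criterion\<close>

theorem theorem5:
  fixes D :: "(real^'n) set"
  assumes "D \<subseteq> sphere 0 1"
  shows "(\<forall>f \<in> schwartz_space.
            (\<forall>v\<in>D. \<forall>x. xray v f x = 0) \<longleftrightarrow> (\<forall>k \<in> normal_set D. fourier_transform f k = 0))
       \<and> (inj_on (restricted_xray D) schwartz_space \<longleftrightarrow> closure (normal_set D) = UNIV)"
proof -
  have unit: "norm v = 1" if "v \<in> D" for v
    using assms that by auto
  have iff: "(\<forall>v\<in>D. \<forall>x. xray v f x = 0) \<longleftrightarrow> (\<forall>k \<in> normal_set D. fourier_transform f k = 0)"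
    if f: "f \<in> schwartz_space" for f
    using xray_eq_0_iff[OF f unit] by (auto simp: normal_set_def)
  have "inj_on (restricted_xray D) schwartz_space" if dense: "closure (normal_set D) = UNIV"
  proof (rule inj_onI)
    fix f g assume f: "f \<in> schwartz_space" and g: "g \<in> schwartz_space"
      and eq: "restricted_xray D f = restricted_xray D g"
    let ?d = "\<lambda>x. f x - g x"
    have d: "?d \<in> schwartz_space" by (rule schwartz_space_diff[OF f g])
    have "xray v ?d x = 0" if "v \<in> D" for v x
    proof -
      have "xray v f = xray v g"
        using fun_cong[OF eq, of v] that by (simp add: restricted_xray_def)
      \<comment> \<open>Integrability of \<open>f\<close> and \<open>g\<close> along the line is
        what permits splitting the integral of the difference.\<close>
      then show ?thesis
        using integrable_schwartz_line[OF f unit[OF that]] integrable_schwartz_line[OF g unit[OF that]]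
        by (simp add: xray_def fun_eq_iff)
    qed
    then have "normal_set D \<subseteq> {k. fourier_transform ?d k = 0}"
      using iff[OF d] by auto
    \<comment> \<open>The zero set of the continuous transform is closed and contains a dense set,
      hence is everything.\<close>
    moreover have "closed {k. fourier_transform ?d k = 0}"
      by (intro closed_Collect_eq continuous_on_fourier_transform continuous_intros integrable_schwartz[OF d])
    ultimately have "fourier_transform ?d k = 0" for k
      using closure_minimal dense by blast
    then have "?d x = 0" for x
      by (intro fourier_transform_eq_0D[of ?d] integrable_schwartz[OF d] continuous_on_schwartz[OF d] bounded_schwartz[OF d])
    then show "f = g" by auto
  qed
  moreover have "closure (normal_set D) = UNIV" if inj: "inj_on (restricted_xray D) schwartz_space"
  proof (rule ccontr)
    assume "closure (normal_set D) \<noteq> UNIV"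
    then obtain a where "a \<in> - closure (normal_set D)" by auto
    then obtain r where r: "r > 0" "ball a r \<subseteq> - closure (normal_set D)"
      using open_contains_ball[of "- closure (normal_set D)"] by auto
    obtain f where f: "f \<in> schwartz_space" "fourier_transform f a \<noteq> 0"
      "\<And>k. k \<notin> ball a r \<Longrightarrow> fourier_transform f k = 0"
      using exists_schwartz_fourier_transform_support[OF r(1), of a] by blast
    have "fourier_transform f k = 0" if "k \<in> normal_set D" for k
      using f(3) r(2) that closure_subset by blast
    then have "\<forall>v\<in>D. \<forall>x. xray v f x = 0"
      using iff[OF f(1)] by blast
    \<comment> \<open>On \<open>D\<close> both sides vanish, and off \<open>D\<close>
      \<open>restrict\<close> returns the same default.\<close>
    then have "restricted_xray D f = restricted_xray D (\<lambda>_. 0)"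
      by (auto simp: restricted_xray_def restrict_def xray_def fun_eq_iff)
    then have "f = (\<lambda>_. 0)"
      using inj f(1) zero_in_schwartz_space by (auto dest: inj_onD)
    with f(2) show False by (simp add: fourier_transform_def)
  qed
  ultimately show ?thesis using iff by blast
qed

end
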